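(* Suppose that $\Delta$ is simply-laced and let $\alpha\in\Pi$ be a simple root such that the nilradical $\mathfrak n_\alpha$ of the maximal parabolic subalgebra $\mathfrak p_\alpha\supset\mathfrak b$ is abelian and $(\alpha,\theta)=0$. Then $\mathsf{Ess}(\mathcal F_{\mathfrak n_\alpha})=I(\mathfrak n_\alpha)$.
   Context: Let $\mathfrak g$ be a simple complex Lie algebra with Borel subalgebra $\mathfrak b=\mathfrak t\oplus\mathfrak u^+$, $\Delta$ the root system of $(\mathfrak g,\mathfrak t)$, $\Delta^+$ the positive roots (roots of $\mathfrak u^+$), $\Pi$ the simple roots, $\theta$ the highest root, $W$ the Weyl group, $(\ ,\ )$ a $W$-invariant scalar product, $\sigma_\alpha$ the reflection in $\alpha$. Length in $W$ is with respect to the simple reflections. For $w\in W$, $\mathcal N(w)=\{\gamma\in\Delta^+\mid w(\gamma)\in-\Delta^+\}$. For a subset $\mathcal F\subset W$ that is a minimal inversion complete set (i.e. $\bigcup_{w\in\mathcal F}\mathcal N(w)=\Delta^+$ and this fails for every proper subset of $\mathcal F$), $\mathsf{Ess}(\mathcal F)$ is the set of $\gamma\in\Delta^+$ such that there is a unique $w\in\mathcal F$ with $\gamma\in\mathcal N(w)$. For $\alpha\in\Pi$, let $[\gamma:\alpha]$ be the coefficient of $\alpha$ in the expansion of $\gamma$ in simple roots. $\mathfrak p_\alpha$ is the standard maximal parabolic subalgebra whose nilradical $\mathfrak n_\alpha$ has the set of roots $I(\mathfrak n_\alpha)=\{\gamma\in\Delta^+\mid[\gamma:\alpha]\ge1\}$;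 it is abelian if and only if $[\theta:\alpha]=1$, in which case $\mathfrak n_\alpha$ is a maximal abelian ideal of $\mathfrak b$, and the simple root corresponding to it under the standard bijection between simple roots and maximal abelian ideals is $\alpha$. Then $$\mathcal F_{\mathfrak n_\alpha}=\{\tilde w_\gamma\mid\gamma\in I(\mathfrak n_\alpha)\},\qquad \tilde w_\gamma=\sigma_\alpha w_{\gamma,\alpha},$$ where $w_{\gamma,\alpha}$ is the unique element of minimal length in $W$ taking $\gamma$ to $\alpha$. This $\mathcal F_{\mathfrak n_\alpha}$ is a minimal inversion complete set. *)

theory Defs
  imports "HOL-Analysis.Analysis"
begin

section \<open>Root systems in a Euclidean space\<close>

definition reflection :: "'v::euclidean_space \<Rightarrow> 'v \<Rightarrow> 'v" where
  "reflection \<gamma> v = v - (2 * (v \<bullet> \<gamma>) / (\<gamma> \<bullet> \<gamma>)) *\<^sub>R \<gamma>"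

inductive_set weyl_group :: "'v::euclidean_space set \<Rightarrow> ('v \<Rightarrow> 'v) set" for \<Delta> where
  id: "id \<in> weyl_group \<Delta>"
| reflection: "\<gamma> \<in> \<Delta> \<Longrightarrow> w \<in> weyl_group \<Delta> \<Longrightarrow> reflection \<gamma> \<circ> w \<in> weyl_group \<Delta>"

text \<open>The coefficient $[\gamma:\alpha]$ of a simple root is \<open>representation B \<gamma> \<alpha>\<close>.\<close>

definition simple_system :: "'v::euclidean_space set \<Rightarrow> 'v set \<Rightarrow> bool" where
  "simple_system \<Delta> B \<longleftrightarrow>
     B \<subseteq> \<Delta> \<and> independent B \<and> \<Delta> \<subseteq> span B \<and>
     (\<forall>\<gamma>\<in>\<Delta>. (\<forall>\<beta>\<in>B. representation B \<gamma> \<beta> \<in> \<nat>) \<or> (\<forall>\<beta>\<in>B. - representation B \<gamma> \<beta> \<in> \<nat>))"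

definition pos_roots :: "'v::euclidean_space set \<Rightarrow> 'v set \<Rightarrow> 'v set" where
  "pos_roots \<Delta> B = {\<gamma> \<in> \<Delta>. \<forall>\<beta>\<in>B. representation B \<gamma> \<beta> \<ge> 0}"

definition highest_root :: "'v::euclidean_space set \<Rightarrow> 'v set \<Rightarrow> 'v \<Rightarrow> bool" where
  "highest_root \<Delta> B \<theta> \<longleftrightarrow>
     \<theta> \<in> \<Delta> \<and> (\<forall>\<gamma>\<in>\<Delta>. \<forall>\<beta>\<in>B. representation B \<gamma> \<beta> \<le> representation B \<theta> \<beta>)"

definition simply_laced :: "'v::euclidean_space set \<Rightarrow> bool" where
  "simply_laced \<Delta> \<longleftrightarrow> (\<forall>\<gamma>\<in>\<Delta>. \<forall>\<delta>\<in>\<Delta>. norm \<gamma> = norm \<delta>)"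

definition weyl_length :: "'v::euclidean_space set \<Rightarrow> ('v \<Rightarrow> 'v) \<Rightarrow> nat" where
  "weyl_length B w =
     (LEAST n. \<exists>bs. set bs \<subseteq> B \<and> length bs = n \<and> w = foldr (\<lambda>\<beta> u. reflection \<beta> \<circ> u) bs id)"

definition inversions :: "'v::euclidean_space set \<Rightarrow> 'v set \<Rightarrow> ('v \<Rightarrow> 'v) \<Rightarrow> 'v set" where
  "inversions \<Delta> B w = {\<gamma> \<in> pos_roots \<Delta> B. - w \<gamma> \<in> pos_roots \<Delta> B}"

definition Ess :: "'v::euclidean_space set \<Rightarrow> 'v set \<Rightarrow> ('v \<Rightarrow> 'v) set \<Rightarrow> 'v set" where
  "Ess \<Delta> B F = {\<gamma> \<in> pos_roots \<Delta> B. \<exists>!w. w \<in> F \<and> \<gamma> \<in> inversions \<Delta> B w}"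

definition nilradical_roots :: "'v::euclidean_space set \<Rightarrow> 'v set \<Rightarrow> 'v \<Rightarrow> 'v set" where
  "nilradical_roots \<Delta> B \<alpha> = {\<gamma> \<in> pos_roots \<Delta> B. representation B \<gamma> \<alpha> \<ge> 1}"

text \<open>The element $w_{\gamma,\alpha}$; for \<open>\<gamma>\<close> positive and \<open>\<alpha>\<close> simple
  in the same orbit there is exactly one element of minimal length to choose from.\<close>

definition shortest_to :: "'v::euclidean_space set \<Rightarrow> 'v set \<Rightarrow> 'v \<Rightarrow> 'v \<Rightarrow> 'v \<Rightarrow> 'v" where
  "shortest_to \<Delta> B \<gamma> \<alpha> = (ARG_MIN (weyl_length B) w. w \<in> weyl_group \<Delta> \<and> w \<gamma> = \<alpha>)"

definition nilradical_family :: "'v::euclidean_space set \<Rightarrow> 'v set \<Rightarrow> 'v \<Rightarrow> ('v \<Rightarrow> 'v) set" where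
  "nilradical_family \<Delta> B \<alpha> =
     {reflection \<alpha> \<circ> shortest_to \<Delta> B \<gamma> \<alpha> | \<gamma>. \<gamma> \<in> nilradical_roots \<Delta> B \<alpha>}"

section \<open>Simple complex Lie algebras and their roots\<close>

locale complex_lie_algebra = vector_space scl
  for scl :: "complex \<Rightarrow> 'g::ab_group_add \<Rightarrow> 'g" +
  fixes br :: "'g \<Rightarrow> 'g \<Rightarrow> 'g"
  assumes br_linear_right: "Vector_Spaces.linear scl scl (br x)"
    and br_linear_left: "Vector_Spaces.linear scl scl (\<lambda>x. br x y)"
    and br_self: "br x x = 0"
    and jacobi: "br x (br y z) + br y (br z x) + br z (br x y) = 0"
begin

definition lie_ideal :: "'g set \<Rightarrow> bool" where
  "lie_ideal I \<longleftrightarrow> subspace I \<and> (\<forall>x. \<forall>y\<in>I. br x y \<in> I)"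

text \<open>For semisimple algebras: a self-centralising commutative subalgebra
  acting by diagonalisable operators.\<close>

definition cartan_subalgebra :: "'g set \<Rightarrow> bool" where
  "cartan_subalgebra t \<longleftrightarrow>
     subspace t \<and> (\<forall>h\<in>t. \<forall>h'\<in>t. br h h' = 0) \<and>
     (\<forall>x. (\<forall>h\<in>t. br h x = 0) \<longrightarrow> x \<in> t) \<and>
     (\<forall>h\<in>t. span {x. \<exists>c. br h x = scl c x} = UNIV)"

end

locale simple_complex_lie_algebra = complex_lie_algebra +
  assumes finite_dim: "\<exists>S. finite S \<and> span S = UNIV"
    and non_abelian: "\<exists>x y. br x y \<noteq> 0"
    and no_ideals: "lie_ideal I \<Longrightarrow> I = {0} \<or> I = UNIV"

text \<open>A vector \<open>\<gamma>\<close> of a Euclidean space denotes the functional \<open>ev \<gamma>\<close>, of which only the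
  restriction to \<open>t\<close> matters.\<close>

definition root_space ::
  "(complex \<Rightarrow> 'g \<Rightarrow> 'g) \<Rightarrow> ('g \<Rightarrow> 'g \<Rightarrow> 'g) \<Rightarrow> 'g set \<Rightarrow> ('v \<Rightarrow> 'g \<Rightarrow> complex) \<Rightarrow> 'v \<Rightarrow> 'g set" where
  "root_space scl br t ev \<gamma> = {x. \<forall>h\<in>t. br h x = scl (ev \<gamma> h) x}"

definition roots ::
  "(complex \<Rightarrow> 'g::zero \<Rightarrow> 'g) \<Rightarrow> ('g \<Rightarrow> 'g \<Rightarrow> 'g) \<Rightarrow> 'g set \<Rightarrow> ('v::zero \<Rightarrow> 'g \<Rightarrow> complex) \<Rightarrow> 'v set" where
  "roots scl br t ev = {\<gamma>. \<gamma> \<noteq> 0 \<and> root_space scl br t ev \<gamma> \<noteq> {0}}"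

text \<open>The map \<open>ev\<close> identifies the Euclidean space \<open>'v\<close> with the real span of the roots in the dual
  of \<open>t\<close>. By \<open>reflection_roots\<close> the orthogonal reflections in the roots permute the roots. As the
  roots are finitely many and span \<open>'v\<close>, a reflection negating a given root and permuting the
  roots is unique; so these generate the Weyl group, and the assumption says that
  the inner product of \<open>'v\<close> is invariant under it.\<close>

locale simple_lie_algebra_roots = simple_complex_lie_algebra scl br
  for scl :: "complex \<Rightarrow> 'g::ab_group_add \<Rightarrow> 'g" and br +
  fixes t :: "'g set" and ev :: "'v::euclidean_space \<Rightarrow> 'g \<Rightarrow> complex"
  assumes cartan: "cartan_subalgebra t"
    and ev_real_linear: "h \<in> t \<Longrightarrow> Real_Vector_Spaces.linear (\<lambda>v. ev v h)"
    and ev_add: "h \<in> t \<Longrightarrow> h' \<in> t \<Longrightarrow> ev v (h + h') = ev v h + ev v h'"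
    and ev_scale: "h \<in> t \<Longrightarrow> ev v (scl c h) = c * ev v h"
    and ev_inj: "(\<And>h. h \<in> t \<Longrightarrow> ev v h = 0) \<Longrightarrow> v = 0"
    and ev_weights: "x \<noteq> 0 \<Longrightarrow> (\<And>h. h \<in> t \<Longrightarrow> br h x = scl (l h) x) \<Longrightarrow> \<exists>v. \<forall>h\<in>t. ev v h = l h"
    and span_roots: "Real_Vector_Spaces.span (roots scl br t ev) = UNIV"
    and reflection_roots: "\<gamma> \<in> roots scl br t ev \<Longrightarrow> \<delta> \<in> roots scl br t ev \<Longrightarrow>
      reflection \<gamma> \<delta> \<in> roots scl br t ev"

text \<open>The nilradical of the maximal parabolic subalgebra
  $t \oplus \bigoplus_{\gamma \in \Delta,\, [\gamma:\alpha] \ge 0} g_\gamma$, which contains the Borel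
  subalgebra $t \oplus \bigoplus_{\gamma \in \Delta^+} g_\gamma$.\<close>

definition nilradical ::
  "(complex \<Rightarrow> 'g::ab_group_add \<Rightarrow> 'g) \<Rightarrow> ('g \<Rightarrow> 'g \<Rightarrow> 'g) \<Rightarrow> 'g set \<Rightarrow>
   ('v::euclidean_space \<Rightarrow> 'g \<Rightarrow> complex) \<Rightarrow> 'v set \<Rightarrow> 'v \<Rightarrow> 'g set" where
  "nilradical scl br t ev B \<alpha> =
     module.span scl (\<Union>\<gamma> \<in> nilradical_roots (roots scl br t ev) B \<alpha>. root_space scl br t ev \<gamma>)"

definition abelian :: "('g::zero \<Rightarrow> 'g \<Rightarrow> 'g) \<Rightarrow> 'g set \<Rightarrow> bool" where
  "abelian br S \<longleftrightarrow> (\<forall>x\<in>S. \<forall>y\<in>S. br x y = 0)"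

end

theory Submission
  imports Defs
begin

text \<open>
  Write \<open>I\<close> for the set of positive roots in which \<open>\<alpha>\<close> has positive coefficient, and
  \<open>\<langle>x, y\<rangle> = 2 (x, y) / q\<close>, where \<open>q\<close> is the common squared length of the roots.  On roots this takes
  only the values \<open>0, \<plusminus>1, \<plusminus>2\<close>, the value \<open>2\<close> only for equal roots.

  Commutativity of the nilradical forces \<open>\<alpha>\<close> to have coefficient at most one in every root.  The
  point is that \<open>[g\<^sub>\<gamma>, g\<^sub>\<delta>] \<noteq> 0\<close> whenever \<open>\<gamma>\<close>, \<open>\<delta>\<close> and \<open>\<gamma> + \<delta>\<close> are roots
  (\<open>bracket_root_spaces_nonzero\<close>).  Usually this rests on nondegeneracy of the Killing form.  Here
  simplicity of the algebra is used directly: call \<open>\<gamma>\<close> degenerate if \<open>[g\<^sub>\<gamma>, g\<^sub>-\<^sub>\<gamma>] = 0\<close>.  In the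
  simply-laced case root strings have at most two members other than \<open>0\<close>, and elementary
  computations with such strings show that the degenerate root spaces span an ideal, which must
  vanish.  A root that is not degenerate has vectors \<open>e\<close>, \<open>f\<close>, \<open>h = [e, f]\<close> as in \<open>sl\<^sub>2\<close>, which gives
  the claim.

  Next, every element of minimal length taking \<open>\<gamma> \<in> I\<close> to \<open>\<alpha>\<close> is a product of simple reflections
  that lower the height by one at each step, and \<open>\<sigma>\<^sub>\<alpha>\<close> is not among them.  This determines
  the inversion set of the member of the family attached to \<open>\<gamma>\<close>: it consists of \<open>\<gamma>\<close> and of
  those positive roots \<open>\<mu>\<close> outside \<open>I\<close> that satisfy \<open>\<langle>\<mu>, \<gamma>\<rangle> > 0\<close> (\<open>inversions_shortest_to\<close>).  So each
  element of \<open>I\<close> is inverted by exactly one member, and it remains to see that a positive root \<open>\<mu>\<close>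
  outside \<open>I\<close> never has \<open>\<langle>\<mu>, \<gamma>\<rangle> > 0\<close> for exactly one \<open>\<gamma> \<in> I\<close>.

  Call \<open>\<gamma>, \<delta> \<in> I\<close> neighbours if \<open>\<langle>\<gamma>, \<delta>\<rangle> = 1\<close>; otherwise distinct elements of \<open>I\<close> are orthogonal.
  If \<open>a, c\<close> are orthogonal with common neighbour \<open>b\<close>, then \<open>a + c - b \<in> I\<close> (\<open>rectangle_root\<close>), and
  this implies that any element orthogonal to \<open>\<alpha>\<close> has a common neighbour with it.  As \<open>\<theta>\<close> is orthogonal
  to \<open>\<alpha>\<close>, reflections in the other simple roots provide for each \<open>a \<in> I\<close> an orthogonal \<open>\<delta> \<in> I\<close> and a
  common neighbour \<open>\<eta>\<close>.  If \<open>a\<close> were the only element of \<open>I\<close> pairing positively with \<open>\<mu>\<close>,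
  then \<open>a - \<mu>\<close> would be the only one pairing negatively, so that \<open>\<delta>\<close> and \<open>\<eta>\<close> are orthogonal to \<open>\<mu>\<close>; but
  then \<open>a + \<delta> - \<eta> \<noteq> a\<close> also pairs positively with \<open>\<mu>\<close>, a contradiction.
\<close>

section \<open>Brackets and simultaneous eigenvectors\<close>

context complex_lie_algebra
begin

lemma br_simps:
  "br x (y + z) = br x y + br x z"
  "br (x + y) z = br x z + br y z"
  "br x (scl c y) = scl c (br x y)"
  "br (scl c x) y = scl c (br x y)"
  using br_linear_right[of x] br_linear_left unfolding Vector_Spaces.linear_iff by blast+

lemma br_zero: "br x 0 = 0" "br 0 x = 0"
  using br_simps(3)[of x 0 0] br_simps(4)[of 0 0 x] by simp_all

lemma br_anti: "br y x = - br x y"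
proof -
  have "br (x + y) (x + y) = 0" "br x x = 0" "br y y = 0" by (rule br_self)+
  thus ?thesis unfolding br_simps by (simp add: add_eq_0_iff)
qed

lemma br_minus: "br x (- y) = - br x y" "br (- x) y = - br x y"
  using br_simps(3)[of x "-1" y] br_simps(4)[of "-1" x y] by simp_all

lemma br_sum: "br x (\<Sum>a\<in>F. f a) = (\<Sum>a\<in>F. br x (f a))"
  by (induction F rule: infinite_finite_induct) (simp_all add: br_zero br_simps)

lemma br_derivation: "br x (br y z) = br (br x y) z + br y (br x z)"
proof -
  have "br y (br z x) = - br y (br x z)" "br z (br x y) = - br (br x y) z"
    using br_anti[of z x] br_anti[of z "br x y"] by (simp_all add: br_minus)
  hence "br x (br y z) - (br (br x y) z + br y (br x z)) = 0"
    using jacobi[of x y z] by (simp add: algebra_simps)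
  thus ?thesis by simp
qed

lemma br_span:
  assumes "subspace V" "\<And>a b. a \<in> S \<Longrightarrow> b \<in> T \<Longrightarrow> br a b \<in> V" "x \<in> span S" "y \<in> span T"
  shows "br x y \<in> V"
proof -
  have "subspace {y. br a y \<in> V}" for a
    using assms(1) by (auto simp: subspace_def br_zero br_simps)
  hence 1: "br a y \<in> V" if "a \<in> S" for a
    using span_induct[OF assms(4), of "\<lambda>y. br a y \<in> V"] assms(2) that by blast
  have "subspace {x. br x y \<in> V}"
    using assms(1) by (auto simp: subspace_def br_zero br_simps)
  thus ?thesis
    using span_induct[OF assms(3), of "\<lambda>x. br x y \<in> V"] 1 by blast
qed

text \<open>Applying \<open>ad h - a\<close> removes the component of eigenvalue \<open>a\<close> and multiplies the others by
  nonzero scalars, so the number of components can be reduced one at a time.\<close>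

lemma eigen_components_in_invariant_subspace:
  assumes "finite C" "subspace W" "\<And>x. x \<in> W \<Longrightarrow> br h x \<in> W"
    and "\<And>c. c \<in> C \<Longrightarrow> br h (v c) = scl c (v c)" "(\<Sum>c\<in>C. v c) \<in> W" "c \<in> C"
  shows "v c \<in> W"
  using assms(1,4-6)
proof (induction C arbitrary: v c)
  case (insert a C)
  let ?x = "\<Sum>c\<in>insert a C. v c"
  have "br h ?x = (\<Sum>c\<in>insert a C. scl c (v c))"
    unfolding br_sum using insert.prems(1) by (intro sum.cong) auto
  hence "br h ?x - scl a ?x = (\<Sum>c\<in>insert a C. scl (c - a) (v c))"
    by (simp only: scale_sum_right sum_subtractf scale_left_diff_distrib)
  also have "\<dots> = (\<Sum>c\<in>C. scl (c - a) (v c))" using insert.hyps by simp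
  finally have "(\<Sum>c\<in>C. scl (c - a) (v c)) \<in> W" 
    using subspace_diff[OF assms(2) assms(3)[OF insert.prems(2)] subspace_scale[OF assms(2) insert.prems(2)], of a]
    by simp
  hence sum: "(\<Sum>c\<in>C. scl (c - a) (v c)) \<in> W" by simp
  have "scl (c - a) (v c) \<in> W" if "c \<in> C" for c
  proof (rule insert.IH[of "\<lambda>c. scl (c - a) (v c)" c])
    show "br h (scl (c - a) (v c)) = scl c (scl (c - a) (v c))" if "c \<in> C" for c
      using that insert.prems(1)[of c] by (simp add: br_simps mult.commute)
  qed (use that sum in simp_all)
  hence *: "v c \<in> W" if c: "c \<in> C" for c
  proof -
    have "c - a \<noteq> 0" using c insert.hyps by auto
    moreover have "scl (inverse (c - a)) (scl (c - a) (v c)) \<in> W"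
      by (rule subspace_scale[OF assms(2) \<open>\<And>c. c \<in> C \<Longrightarrow> scl (c - a) (v c) \<in> W\<close>[OF c]])
    ultimately show ?thesis by simp
  qed
  have "v a = ?x - (\<Sum>c\<in>C. v c)" using insert.hyps by simp
  also have "\<dots> \<in> W"
    by (rule subspace_diff[OF assms(2) insert.prems(2) subspace_sum[OF assms(2) *]])
  finally show ?case using * insert.prems(3) by blast
qed simp

lemma eigen_decomposition:
  assumes "x \<in> span {x. \<exists>c. br h x = scl c x}"
  obtains C v where "finite C" "\<And>c. c \<in> C \<Longrightarrow> br h (v c) = scl c (v c)" "x = (\<Sum>c\<in>C. v c)"
proof -
  obtain S r where S: "finite S" "S \<subseteq> {x. \<exists>c. br h x = scl c x}" "x = (\<Sum>a\<in>S. scl (r a) a)"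
    using assms unfolding span_explicit by blast
  hence "\<forall>a\<in>S. \<exists>c. br h a = scl c a" by blast
  then obtain g where g: "\<And>a. a \<in> S \<Longrightarrow> br h a = scl (g a) a" by metis
  define v where "v c = (\<Sum>a\<in>{a \<in> S. g a = c}. scl (r a) a)" for c
  have "br h (v c) = scl c (v c)" for c
    unfolding v_def br_sum scale_sum_right
    by (intro sum.cong) (auto simp: br_simps g mult.commute)
  moreover have "x = (\<Sum>c\<in>g ` S. v c)"
    unfolding S(3) v_def by (rule sum.image_gen[OF S(1)])
  ultimately show thesis using that[of "g ` S" v] S(1) by blast
qed

text \<open>The operators \<open>ad h\<close> for \<open>h \<in> H\<close> commute, so each simultaneous eigenspace of those already
  treated is invariant under the next one and contains the components of its elements.\<close>

lemma simultaneous_eigenvectors_span: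
  assumes "finite H" "\<And>h h'. h \<in> H \<Longrightarrow> h' \<in> H \<Longrightarrow> br h h' = 0"
    and "\<And>h. h \<in> H \<Longrightarrow> span {x. \<exists>c. br h x = scl c x} = UNIV"
  shows "span {x. \<exists>l. \<forall>h\<in>H. br h x = scl (l h) x} = UNIV"
  using assms
proof (induction H)
  case (insert h H)
  let ?E = "{x. \<exists>l. \<forall>h'\<in>insert h H. br h' x = scl (l h') x}"
  have "x \<in> span ?E" if x: "\<forall>h\<in>H. br h x = scl (l h) x" for x l
  proof -
    let ?W = "{y. \<forall>h'\<in>H. br h' y = scl (l h') y}"
    have W: "subspace ?W"
      by (auto simp: subspace_def br_zero br_simps scale_right_distrib mult.commute)
    have inv: "br h y \<in> ?W" if y: "y \<in> ?W" for y
    proof (intro CollectI ballI)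
      fix h' assume h': "h' \<in> H"
      have "br h' (br h y) = br (br h' h) y + br h (br h' y)" by (rule br_derivation)
      also have "br h' h = 0" using insert.prems(1) h' by blast
      also have "br h' y = scl (l h') y" using y h' by blast
      finally show "br h' (br h y) = scl (l h') (br h y)" by (simp add: br_simps br_zero)
    qed
    obtain C v where v: "finite C" "\<And>c. c \<in> C \<Longrightarrow> br h (v c) = scl c (v c)" "x = (\<Sum>c\<in>C. v c)"
      using eigen_decomposition[of x h] insert.prems(2)[of h] by blast
    have "v c \<in> ?E" if "c \<in> C" for c
    proof -
      have "v c \<in> ?W"
        using eigen_components_in_invariant_subspace[where v = v, OF v(1) W inv v(2) _ that] x v(3) by simp
      thus ?thesis
        using v(2)[OF that] insert.hyps(2) by (intro CollectI exI[of _ "l(h := c)"]) auto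
    qed
    thus ?thesis unfolding v(3) by (intro span_sum span_base)
  qed
  hence "{x. \<exists>l. \<forall>h\<in>H. br h x = scl (l h) x} \<subseteq> span ?E" by blast
  hence "span {x. \<exists>l. \<forall>h\<in>H. br h x = scl (l h) x} \<subseteq> span ?E"
    by (simp add: span_minimal)
  thus ?case using insert by auto
qed (simp add: span_UNIV)

end

section \<open>Root spaces of a simply-laced simple Lie algebra\<close>

locale simply_laced_lie_algebra = simple_lie_algebra_roots scl br t ev
  for scl :: "complex \<Rightarrow> 'g::ab_group_add \<Rightarrow> 'g" and br t
    and ev :: "'v::euclidean_space \<Rightarrow> 'g \<Rightarrow> complex" +
  assumes equal_norms: "\<gamma> \<in> roots scl br t ev \<Longrightarrow> \<delta> \<in> roots scl br t ev \<Longrightarrow> \<gamma> \<bullet> \<gamma> = \<delta> \<bullet> \<delta>"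
begin

abbreviation R :: "'v set" where "R \<equiv> roots scl br t ev"
abbreviation g :: "'v \<Rightarrow> 'g set" where "g \<equiv> root_space scl br t ev"

lemma subspace_t: "subspace t"
  and t_commutes: "h \<in> t \<Longrightarrow> h' \<in> t \<Longrightarrow> br h h' = 0"
  and t_self_centralising: "(\<And>h. h \<in> t \<Longrightarrow> br h x = 0) \<Longrightarrow> x \<in> t"
  and t_diagonalisable: "h \<in> t \<Longrightarrow> span {x. \<exists>c. br h x = scl c x} = UNIV"
  using cartan unfolding cartan_subalgebra_def by blast+

lemma ev_simps:
  assumes "h \<in> t"
  shows "ev (v + w) h = ev v h + ev w h" "ev (v - w) h = ev v h - ev w h"
    "ev (- v) h = - ev v h" "ev 0 h = 0"
proof -
  interpret ev: Real_Vector_Spaces.linear "\<lambda>v. ev v h" by (rule ev_real_linear[OF assms])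
  show "ev (v + w) h = ev v h + ev w h" "ev (v - w) h = ev v h - ev w h"
    "ev (- v) h = - ev v h" "ev 0 h = 0"
    by (rule ev.add ev.diff ev.neg ev.zero)+
qed

lemma root_space_br: "h \<in> t \<Longrightarrow> x \<in> g \<gamma> \<Longrightarrow> br h x = scl (ev \<gamma> h) x"
  by (simp add: root_space_def)

lemma subspace_root_space: "subspace (g \<gamma>)"
  by (auto simp: subspace_def root_space_def br_zero br_simps scale_right_distrib mult.commute)

lemma br_root_space:
  assumes "x \<in> g \<gamma>" "y \<in> g \<delta>" "\<gamma> + \<delta> = \<eta>"
  shows "br x y \<in> g \<eta>"
  using assms
  by (auto simp: root_space_def br_derivation[of _ x] br_simps ev_simps scale_left_distrib)

lemma root_space_0: "g 0 = t"
  using t_commutes by (auto simp: root_space_def ev_simps intro: t_self_centralising)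

lemma br_opposite: "x \<in> g \<gamma> \<Longrightarrow> y \<in> g (- \<gamma>) \<Longrightarrow> br x y \<in> t"
  using br_root_space[of x \<gamma> y "- \<gamma>" 0] by (simp add: root_space_0)

lemma root_nonzero: "\<gamma> \<in> R \<Longrightarrow> \<gamma> \<noteq> 0"
  by (simp add: roots_def)

lemma root_space_nonroot: "x \<in> g \<gamma> \<Longrightarrow> \<gamma> \<noteq> 0 \<Longrightarrow> \<gamma> \<notin> R \<Longrightarrow> x = 0"
  by (auto simp: roots_def)

lemma root_vector:
  assumes "\<gamma> \<in> R"
  obtains x where "x \<in> g \<gamma>" "x \<noteq> 0"
  using assms subspace_0[OF subspace_root_space[of \<gamma>]] unfolding roots_def by blast

text \<open>A finite basis of \<open>t\<close> is diagonalised simultaneously; its eigenvectors are eigenvectors of all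
  of \<open>t\<close> by linearity, and the eigenvalue is a weight, hence zero or a root.\<close>

lemma root_space_decomposition: "span (t \<union> (\<Union>\<gamma>\<in>R. g \<gamma>)) = UNIV"
proof -
  obtain S where S: "finite S" "span S = UNIV" using finite_dim by blast
  obtain C where C: "C \<subseteq> t" "independent C" "t \<subseteq> span C"
    using maximal_independent_subset by blast
  have fin: "finite C" using independent_span_bound[OF S(1) C(2)] S by simp
  have "x \<in> t \<union> (\<Union>\<gamma>\<in>R. g \<gamma>)" if l: "\<forall>h\<in>C. br h x = scl (l h) x" for x l
  proof (cases "x = 0")
    case True
    thus ?thesis using subspace_0[OF subspace_t] by simp
  next
    case False
    have "subspace {h. \<exists>c. br h x = scl c x}"
    proof (unfold subspace_def, intro conjI ballI allI)
      show "0 \<in> {h. \<exists>c. br h x = scl c x}" by (auto simp: br_zero intro: exI[of _ 0])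
    qed (auto simp: br_simps scale_left_distrib[symmetric])
    hence "\<exists>c. br h x = scl c x" if "h \<in> t" for h
      using span_induct[of h C "\<lambda>h. \<exists>c. br h x = scl c x"] that C(3) l by blast
    then obtain m where m: "\<And>h. h \<in> t \<Longrightarrow> br h x = scl (m h) x" by metis
    then obtain \<gamma> where \<gamma>: "\<And>h. h \<in> t \<Longrightarrow> ev \<gamma> h = m h" using ev_weights[OF False] by blast
    have "x \<in> g \<gamma>" using m \<gamma> by (simp add: root_space_def)
    thus ?thesis using root_space_nonroot False root_space_0 by (cases "\<gamma> = 0") auto
  qed
  hence "{x. \<exists>l. \<forall>h\<in>C. br h x = scl (l h) x} \<subseteq> t \<union> (\<Union>\<gamma>\<in>R. g \<gamma>)" by blast
  moreover have "span {x. \<exists>l. \<forall>h\<in>C. br h x = scl (l h) x} = UNIV"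
    using C(1) t_commutes t_diagonalisable by (intro simultaneous_eigenvectors_span fin) blast+
  ultimately show ?thesis using span_mono by blast
qed

lemma central_zero:
  assumes "\<And>x. br z x = 0"
  shows "z = 0"
proof -
  let ?Z = "{z. \<forall>x. br z x = 0}"
  have "lie_ideal ?Z"
    unfolding lie_ideal_def subspace_def
    by (auto simp: br_simps br_zero) (metis br_anti br_zero(1) neg_0_equal_iff_equal)
  hence "?Z = {0} \<or> ?Z = UNIV" by (rule no_ideals)
  thus ?thesis using assms non_abelian by blast
qed

text \<open>Equality of norms alone controls root strings: if \<open>\<gamma>\<close>, \<open>\<delta>\<close> and \<open>\<gamma> + \<delta>\<close> are roots, then
  \<open>\<delta> - \<gamma>\<close> and \<open>\<delta> + 2\<gamma>\<close> have three times the squared length of a root.\<close>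

lemma root_sum_inner:
  assumes "\<gamma> \<in> R" "\<delta> \<in> R" "\<gamma> + \<delta> \<in> R"
  shows "2 * (\<gamma> \<bullet> \<delta>) = - (\<gamma> \<bullet> \<gamma>)" "\<delta> \<bullet> \<delta> = \<gamma> \<bullet> \<gamma>" "\<gamma> \<bullet> \<gamma> > 0"
  using equal_norms[OF assms(3,1)] equal_norms[OF assms(2,1)] root_nonzero[OF assms(1)]
  by (auto simp: inner_simps inner_commute)

lemma root_string:
  assumes "\<gamma> \<in> R" "\<delta> \<in> R" "\<gamma> + \<delta> \<in> R"
  shows "\<delta> - \<gamma> \<notin> R" "\<delta> - \<gamma> \<noteq> 0" "\<gamma> + (\<gamma> + \<delta>) \<notin> R" "\<gamma> + (\<gamma> + \<delta>) \<noteq> 0"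
    "- \<gamma> - (\<gamma> + \<delta>) \<notin> R" "- \<gamma> - (\<gamma> + \<delta>) \<noteq> 0"
proof -
  note s = root_sum_inner[OF assms]
  have 1: "(\<delta> - \<gamma>) \<bullet> (\<delta> - \<gamma>) = 3 * (\<gamma> \<bullet> \<gamma>)"
    using s by (simp add: inner_simps inner_commute)
  have 2: "(\<gamma> + (\<gamma> + \<delta>)) \<bullet> (\<gamma> + (\<gamma> + \<delta>)) = 3 * (\<gamma> \<bullet> \<gamma>)"
    using s by (simp add: inner_simps inner_commute)
  have 3: "(- \<gamma> - (\<gamma> + \<delta>)) \<bullet> (- \<gamma> - (\<gamma> + \<delta>)) = 3 * (\<gamma> \<bullet> \<gamma>)"
    using s by (simp add: inner_simps inner_commute)
  have *: "x \<notin> R" "x \<noteq> 0" if "x \<bullet> x = 3 * (\<gamma> \<bullet> \<gamma>)" for x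
    using that equal_norms[OF _ assms(1), of x] s(3) by auto
  show "\<delta> - \<gamma> \<notin> R" "\<delta> - \<gamma> \<noteq> 0" "\<gamma> + (\<gamma> + \<delta>) \<notin> R" "\<gamma> + (\<gamma> + \<delta>) \<noteq> 0"
    "- \<gamma> - (\<gamma> + \<delta>) \<notin> R" "- \<gamma> - (\<gamma> + \<delta>) \<noteq> 0"
    using *[OF 1] *[OF 2] *[OF 3] by blast+
qed

lemma double_root:
  assumes "\<gamma> \<in> R" shows "\<gamma> + \<gamma> \<notin> R" "\<gamma> + \<gamma> \<noteq> 0"
proof -
  have p: "\<gamma> \<bullet> \<gamma> > 0" using root_nonzero[OF assms] by simp
  thus "\<gamma> + \<gamma> \<notin> R" using equal_norms[OF _ assms, of "\<gamma> + \<gamma>"] by (auto simp: inner_simps)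
  show "\<gamma> + \<gamma> \<noteq> 0" using root_nonzero[OF assms] by (simp flip: scaleR_2)
qed

lemma string_action:
  assumes r: "\<gamma> \<in> R" "\<delta> \<in> R" "\<gamma> + \<delta> \<in> R" and e: "e \<in> g \<gamma>" and f: "f \<in> g (- \<gamma>)"
  shows "x \<in> g \<delta> \<Longrightarrow> br f (br e x) = scl (- ev \<delta> (br e f)) x"
    and "y \<in> g (\<gamma> + \<delta>) \<Longrightarrow> br e (br f y) = scl (ev (\<gamma> + \<delta>) (br e f)) y"
proof -
  have h: "br e f \<in> t" using br_opposite e f by blast
  show "br f (br e x) = scl (- ev \<delta> (br e f)) x" if x: "x \<in> g \<delta>"
  proof -
    have "br f x \<in> g (\<delta> - \<gamma>)" using br_root_space[OF f x] by simp
    hence "br f x = 0" using root_space_nonroot root_string[OF r] by blast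
    hence "br (br e f) x + br f (br e x) = 0" using br_derivation[of e f x] by (simp add: br_zero)
    thus ?thesis using root_space_br[OF h x] by (simp add: add_eq_0_iff)
  qed
  show "br e (br f y) = scl (ev (\<gamma> + \<delta>) (br e f)) y" if y: "y \<in> g (\<gamma> + \<delta>)"
  proof -
    have "br e y \<in> g (\<gamma> + (\<gamma> + \<delta>))" using br_root_space[OF e y] by simp
    hence "br e y = 0" using root_space_nonroot root_string[OF r] by blast
    thus ?thesis using br_derivation[of e f y] root_space_br[OF h y] by (simp add: br_zero)
  qed
qed

text \<open>For \<open>x \<in> g\<^sub>\<delta>\<close>, the vector \<open>[e, [f, [e, x]]]\<close> can be evaluated by either part of
  \<open>string_action\<close>: it is both \<open>(\<gamma> + \<delta>)(h) [e, x]\<close> and \<open>-\<delta>(h) [e, x]\<close> with \<open>h = [e, f]\<close>.  If all \<open>[e, x]\<close>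
  vanish, \<open>string_action\<close> forces \<open>\<delta>(h) = (\<gamma> + \<delta>)(h) = 0\<close> instead.\<close>

lemma string_value:
  assumes r: "\<gamma> \<in> R" "\<delta> \<in> R" "\<gamma> + \<delta> \<in> R" and e: "e \<in> g \<gamma>" and f: "f \<in> g (- \<gamma>)"
  shows "2 * ev \<delta> (br e f) = - ev \<gamma> (br e f)"
    and "ev \<gamma> (br e f) \<noteq> 0 \<Longrightarrow> \<exists>x\<in>g \<delta>. br e x \<noteq> 0"
proof -
  have h: "br e f \<in> t" using br_opposite e f by blast
  note act = string_action[OF r e f]
  have "2 * ev \<delta> (br e f) = - ev \<gamma> (br e f) \<and> (ev \<gamma> (br e f) \<noteq> 0 \<longrightarrow> (\<exists>x\<in>g \<delta>. br e x \<noteq> 0))"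
  proof (cases "\<exists>x\<in>g \<delta>. br e x \<noteq> 0")
    case True
    then obtain x where x: "x \<in> g \<delta>" "br e x \<noteq> 0" by blast
    have "scl (ev (\<gamma> + \<delta>) (br e f)) (br e x) = br e (br f (br e x))"
      using act(2) br_root_space[OF e x(1)] by simp
    also have "\<dots> = scl (- ev \<delta> (br e f)) (br e x)" using act(1)[OF x(1)] by (simp only: br_simps)
    finally have "ev (\<gamma> + \<delta>) (br e f) = - ev \<delta> (br e f)" using x(2) by (simp only: scale_right_imp_eq scale_cancel_right) simp
    hence "2 * ev \<delta> (br e f) = - ev \<gamma> (br e f)"
      using h by (simp add: ev_simps eq_neg_iff_add_eq_0 algebra_simps)
    thus ?thesis using True by blast
  next
    case False
    obtain x where x: "x \<in> g \<delta>" "x \<noteq> 0" using root_vector r by blast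
    have d: "ev \<delta> (br e f) = 0" using act(1)[OF x(1)] False x by (simp add: br_zero)
    obtain y where y: "y \<in> g (\<gamma> + \<delta>)" "y \<noteq> 0" using root_vector r by blast
    have "br f y \<in> g \<delta>" using br_root_space[OF f y(1)] by simp
    hence "ev (\<gamma> + \<delta>) (br e f) = 0" using act(2)[OF y(1)] False y by auto
    thus ?thesis using d h by (simp add: ev_simps)
  qed
  thus "2 * ev \<delta> (br e f) = - ev \<gamma> (br e f)"
    "ev \<gamma> (br e f) \<noteq> 0 \<Longrightarrow> \<exists>x\<in>g \<delta>. br e x \<noteq> 0" by blast+
qed

text \<open>By \<open>string_value\<close> every root vanishes on \<open>[e, f]\<close> as soon as \<open>\<gamma>\<close> does, so \<open>[e, f]\<close> is central;
  the centre of a simple Lie algebra is zero.\<close>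

lemma br_opposite_zero:
  assumes "\<gamma> \<in> R" "e \<in> g \<gamma>" "f \<in> g (- \<gamma>)" "ev \<gamma> (br e f) = 0"
  shows "br e f = 0"
proof (rule central_zero)
  have h: "br e f \<in> t" using br_opposite assms by blast
  have z: "br (br e f) x = 0" if d: "\<delta> \<in> R" and x: "x \<in> g \<delta>" for \<delta> x
  proof -
    consider "\<delta> = \<gamma> \<or> \<delta> = - \<gamma>" | "\<gamma> + \<delta> \<in> R" | "\<delta> - \<gamma> \<in> R"
      | "\<delta> \<noteq> \<gamma>" "\<delta> \<noteq> - \<gamma>" "\<gamma> + \<delta> \<notin> R" "\<delta> - \<gamma> \<notin> R" by blast
    thus ?thesis
    proof cases
      case 1
      hence "ev \<delta> (br e f) = 0" using assms h by (auto simp: ev_simps)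
      thus ?thesis using root_space_br[OF h x] by simp
    next
      case 2
      hence "ev \<delta> (br e f) = 0" using string_value(1)[OF assms(1) d 2 assms(2,3)] assms by simp
      thus ?thesis using root_space_br[OF h x] by simp
    next
      case 3
      hence "ev (\<delta> - \<gamma>) (br e f) = 0"
        using string_value(1)[OF assms(1) 3 _ assms(2,3)] d assms by simp
      hence "ev \<delta> (br e f) = 0" using assms h by (simp add: ev_simps)
      thus ?thesis using root_space_br[OF h x] by simp
    next
      case 4
      have "br f x \<in> g (\<delta> - \<gamma>)" "br e x \<in> g (\<gamma> + \<delta>)"
        using br_root_space assms x by auto
      hence "br f x = 0" "br e x = 0"
        using 4 root_space_nonroot by (metis eq_iff_diff_eq_0, metis add.commute add_eq_0_iff)
      thus ?thesis using br_derivation[of e f x] by (simp add: br_zero)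
    qed
  qed
  fix x
  have "br (br e f) x \<in> {0}"
    by (rule br_span[of "{0}" "{br e f}" "t \<union> (\<Union>\<gamma>\<in>R. g \<gamma>)"])
      (auto simp: root_space_decomposition span_base z t_commutes[OF h])
  thus "br (br e f) x = 0" by simp
qed

text \<open>In fact no root is degenerate (\<open>root_not_degenerate\<close>); the notion serves to prove this.\<close>

definition degenerate :: "'v \<Rightarrow> bool" where
  "degenerate \<gamma> \<longleftrightarrow> (\<forall>e\<in>g \<gamma>. \<forall>f\<in>g (- \<gamma>). br e f = 0)"

lemma nondegenerate_root:
  assumes "\<gamma> \<in> R" "\<not> degenerate \<gamma>"
  obtains e f where "e \<in> g \<gamma>" "f \<in> g (- \<gamma>)" "ev \<gamma> (br e f) \<noteq> 0"
  using assms br_opposite_zero unfolding degenerate_def by blast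

lemma degenerate_commute: "degenerate \<gamma> \<Longrightarrow> e \<in> g \<gamma> \<Longrightarrow> f \<in> g (- \<gamma>) \<Longrightarrow> br f e = 0"
  using br_anti[of f e] by (simp add: degenerate_def)

text \<open>From vectors \<open>e, f\<close> for \<open>\<gamma>\<close> and \<open>e', f'\<close> for \<open>\<gamma> + \<delta>\<close> one gets \<open>[f, e'] \<in> g\<^sub>\<delta>\<close> and
  \<open>[e, f'] \<in> g\<^sub>-\<^sub>\<delta>\<close>, whose bracket is \<open>\<gamma>(h') h - (\<gamma> + \<delta>)(h) h'\<close> with \<open>h = [e, f]\<close> and \<open>h' = [e', f']\<close>.
  The value of \<open>\<delta>\<close> on it is \<open>\<delta>(h) (\<gamma> + \<delta>)(h')\<close>, which is not zero.\<close>

lemma nondegenerate_difference: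
  assumes r: "\<gamma> \<in> R" "\<delta> \<in> R" "\<gamma> + \<delta> \<in> R" and nd: "\<not> degenerate \<gamma>" "\<not> degenerate (\<gamma> + \<delta>)"
  shows "\<not> degenerate \<delta>"
proof -
  obtain e f where ef: "e \<in> g \<gamma>" "f \<in> g (- \<gamma>)" "ev \<gamma> (br e f) \<noteq> 0"
    using nondegenerate_root r nd by blast
  obtain e' f' where ef': "e' \<in> g (\<gamma> + \<delta>)" "f' \<in> g (- (\<gamma> + \<delta>))" "ev (\<gamma> + \<delta>) (br e' f') \<noteq> 0"
    using nondegenerate_root r nd by blast
  define h where "h = br e f"
  define h' where "h' = br e' f'"
  have ht: "h \<in> t" "h' \<in> t" unfolding h_def h'_def using br_opposite ef ef' by blast+
  define y where "y = br f e'"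
  define z where "z = br e f'"
  have y: "y \<in> g \<delta>" unfolding y_def using br_root_space[OF ef(2) ef'(1)] by simp
  have z: "z \<in> g (- \<delta>)" unfolding z_def using br_root_space[OF ef(1) ef'(2)] by simp
  have "br f f' \<in> g (- \<gamma> - (\<gamma> + \<delta>))" by (rule br_root_space[OF ef(2) ef'(2)]) simp
  hence ff: "br f f' = 0" using root_space_nonroot root_string[OF r] by blast
  have "br e e' \<in> g (\<gamma> + (\<gamma> + \<delta>))" using br_root_space[OF ef(1) ef'(1)] by simp
  hence "br e e' = 0" using root_space_nonroot root_string[OF r] by blast
  hence ee: "br e' e = 0" using br_anti[of e' e] by simp
  have "br e (br f f') = br h f' + br f z" unfolding h_def z_def by (rule br_derivation)
  hence fz: "br f z = scl (ev (\<gamma> + \<delta>) h) f'"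
    using ff root_space_br[OF ht(1) ef'(2)] ev_simps(3)[OF ht(1), of "\<gamma> + \<delta>"]
    by (simp add: br_zero add_eq_0_iff)
  have "br e' z = br (br e' e) f' + br e h'" unfolding h'_def z_def by (rule br_derivation)
  hence ez: "br e' z = - scl (ev \<gamma> h') e"
    using ee br_anti[of e h'] root_space_br[OF ht(2) ef(1)] by (simp add: br_zero)
  have "br f (br e' z) = br y z + br e' (br f z)" unfolding y_def by (rule br_derivation)
  hence "br y z = br f (br e' z) - br e' (br f z)" by simp
  also have "\<dots> = scl (ev \<gamma> h') h - scl (ev (\<gamma> + \<delta>) h) h'"
    unfolding ez fz using br_anti[of f e] by (simp add: br_simps br_minus h_def h'_def)
  finally have yz: "br y z = scl (ev \<gamma> h') h + scl (- ev (\<gamma> + \<delta>) h) h'" by simp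
  have "ev \<delta> (br y z) = ev \<gamma> h' * ev \<delta> h - ev (\<gamma> + \<delta>) h * ev \<delta> h'"
    unfolding yz ev_add[OF subspace_scale[OF subspace_t ht(1)] subspace_scale[OF subspace_t ht(2)]]
      ev_scale[OF ht(1)] ev_scale[OF ht(2)] by simp
  moreover have "ev \<gamma> h = - 2 * ev \<delta> h"
    using string_value(1)[OF r ef(1,2)] by (simp add: h_def)
  ultimately have "ev \<delta> (br y z) = ev \<delta> h * ev (\<gamma> + \<delta>) h'"
    using ht by (simp add: ev_simps algebra_simps)
  moreover have "ev \<delta> h \<noteq> 0" using ef(3) \<open>ev \<gamma> h = - 2 * ev \<delta> h\<close> by (auto simp: h_def)
  ultimately have "ev \<delta> (br y z) \<noteq> 0" using ef'(3) by (simp add: h'_def)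
  hence "br y z \<noteq> 0" using ev_scale[of 0 \<delta> 0] subspace_0[OF subspace_t] by auto
  thus ?thesis using y z unfolding degenerate_def by blast
qed

text \<open>By \<open>nondegenerate_difference\<close> both \<open>\<gamma>\<close> and \<open>\<delta>\<close> are degenerate, so by the Jacobi identity \<open>u = [x, y]\<close>
  commutes with all of \<open>g\<close> at \<open>-(\<gamma> + \<delta>)\<close>; it also commutes with \<open>g\<close> at \<open>\<gamma> + \<delta>\<close> since
  twice a root is not a root.  Choosing \<open>e\<close>, \<open>f\<close> in these two spaces such that \<open>\<gamma> + \<delta>\<close> does not vanish on
  \<open>[e, f]\<close>, the latter kills \<open>u\<close> but also acts on it by a nonzero scalar.\<close>

lemma degenerate_bracket:
  assumes r: "\<gamma> \<in> R" "\<delta> \<in> R" "\<gamma> + \<delta> \<in> R" and d: "degenerate \<delta>" "\<not> degenerate (\<gamma> + \<delta>)"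
    and x: "x \<in> g \<gamma>" and y: "y \<in> g \<delta>"
  shows "br x y = 0"
proof -
  have dg: "degenerate \<gamma>" using nondegenerate_difference r d by blast
  define u where "u = br x y"
  have u: "u \<in> g (\<gamma> + \<delta>)" unfolding u_def using br_root_space x y by blast
  obtain e f where ef: "e \<in> g (\<gamma> + \<delta>)" "f \<in> g (- (\<gamma> + \<delta>))" "ev (\<gamma> + \<delta>) (br e f) \<noteq> 0"
    using nondegenerate_root r d by blast
  have "br f x \<in> g (- \<delta>)" "br f y \<in> g (- \<gamma>)"
    using br_root_space[OF ef(2) x] br_root_space[OF ef(2) y] by simp_all
  hence "br (br f x) y = 0" "br x (br f y) = 0"
    using degenerate_commute[OF d(1) y] dg x unfolding degenerate_def by blast+
  hence fu: "br f u = 0" unfolding u_def br_derivation[of f x y] by simp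
  have "br e u \<in> g ((\<gamma> + \<delta>) + (\<gamma> + \<delta>))" using br_root_space[OF ef(1) u] by simp
  hence eu: "br e u = 0" using root_space_nonroot double_root[OF r(3)] by blast
  have "br (br e f) u = 0" using br_derivation[of e f u] fu eu by (simp add: br_zero)
  moreover have "br (br e f) u = scl (ev (\<gamma> + \<delta>) (br e f)) u"
    using root_space_br br_opposite ef u by blast
  ultimately show ?thesis using ef(3) by (simp add: u_def)
qed

text \<open>The sum of the root spaces meets \<open>t\<close> only in zero.  The operator \<open>ad h - \<delta>(h)\<close> with
  \<open>\<delta>(h) \<noteq> 0\<close> acts on \<open>t\<close> as a nonzero scalar and removes one summand.\<close>

lemma root_vector_sum_in_t:
  assumes "finite F" "\<And>a. a \<in> F \<Longrightarrow> \<delta> a \<in> R \<and> f a \<in> g (\<delta> a)" "(\<Sum>a\<in>F. f a) \<in> t"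
  shows "(\<Sum>a\<in>F. f a) = 0"
  using assms
proof (induction F arbitrary: f)
  case (insert a F)
  let ?x = "\<Sum>a\<in>insert a F. f a"
  have "\<delta> a \<noteq> 0" using insert.prems(1) root_nonzero by blast
  then obtain h where h: "h \<in> t" "ev (\<delta> a) h \<noteq> 0" using ev_inj by blast
  let ?f = "\<lambda>b. scl (ev (\<delta> b) h - ev (\<delta> a) h) (f b)"
  have "br h ?x = (\<Sum>b\<in>insert a F. scl (ev (\<delta> b) h) (f b))"
    unfolding br_sum using insert.prems(1) h by (intro sum.cong) (auto simp: root_space_br)
  hence "br h ?x - scl (ev (\<delta> a) h) ?x = (\<Sum>b\<in>insert a F. ?f b)"
    by (simp add: scale_sum_right sum_subtractf scale_left_diff_distrib del: sum.insert)
  moreover have "br h ?x = 0" using t_commutes h insert.prems by blast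
  ultimately have *: "- scl (ev (\<delta> a) h) ?x = (\<Sum>b\<in>F. ?f b)" using insert.hyps by simp
  have "(\<Sum>b\<in>F. ?f b) \<in> t"
    unfolding *[symmetric] using insert.prems subspace_t by (intro subspace_neg subspace_scale)
  hence "(\<Sum>b\<in>F. ?f b) = 0"
    using insert.IH[of ?f] insert.prems(1) subspace_scale[OF subspace_root_space] by simp
  thus ?case using * h by (metis neg_equal_0_iff_equal scale_eq_0_iff)
qed simp

text \<open>The degenerate root spaces span an ideal by \<open>degenerate_bracket\<close>.  It is not the whole
  algebra: it meets \<open>t\<close> only in zero, and \<open>t = 0\<close> would make the algebra its own Cartan
  subalgebra, hence commutative.\<close>

lemma root_not_degenerate:
  assumes "\<gamma> \<in> R"
  shows "\<not> degenerate \<gamma>"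
proof
  assume deg: "degenerate \<gamma>"
  define N where "N = {\<delta> \<in> R. degenerate \<delta>}"
  let ?U = "\<Union>\<delta>\<in>N. g \<delta>"
  have in_I: "x \<in> span ?U" if "x \<in> g \<delta>" "\<delta> \<in> N" for x \<delta>
    using that by (intro span_base) blast
  have "br x y \<in> span ?U" if x: "x \<in> t \<union> (\<Union>\<gamma>\<in>R. g \<gamma>)" and y: "y \<in> ?U" for x y
  proof -
    obtain \<delta> where d: "\<delta> \<in> R" "degenerate \<delta>" "y \<in> g \<delta>" using y by (auto simp: N_def)
    consider "x \<in> t" | \<epsilon> where "\<epsilon> \<in> R" "x \<in> g \<epsilon>" using x by blast
    thus ?thesis
    proof cases
      case 1
      hence "br x y = scl (ev \<delta> x) y" using root_space_br d by blast
      thus ?thesis using y by (simp add: span_base span_scale)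
    next
      case e: 2
      have b: "br x y \<in> g (\<epsilon> + \<delta>)" using br_root_space e d by blast
      consider "\<epsilon> = - \<delta>" | "\<epsilon> + \<delta> \<in> N" | "\<epsilon> + \<delta> \<noteq> 0" "\<epsilon> + \<delta> \<notin> R"
        | "\<epsilon> + \<delta> \<in> R" "\<not> degenerate (\<epsilon> + \<delta>)"
        unfolding N_def by (auto simp: eq_neg_iff_add_eq_0)
      thus ?thesis
      proof cases
        case 1
        thus ?thesis using degenerate_commute d e span_zero by simp
      next
        case 2
        thus ?thesis using in_I b by blast
      next
        case 3
        thus ?thesis using root_space_nonroot[OF b] span_zero by simp
      next
        case 4
        thus ?thesis using degenerate_bracket e d span_zero by simp
      qed
    qed
  qed
  hence "br x y \<in> span ?U" if "y \<in> span ?U" for x y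
    by (rule br_span[OF subspace_span, of "t \<union> (\<Union>\<gamma>\<in>R. g \<gamma>)" ?U])
      (use that root_space_decomposition in simp_all)
  hence "lie_ideal (span ?U)" unfolding lie_ideal_def using subspace_span by blast
  hence "span ?U = {0} \<or> span ?U = UNIV" by (rule no_ideals)
  moreover have "span ?U \<noteq> {0}"
  proof -
    obtain x where "x \<in> g \<gamma>" "x \<noteq> 0" using root_vector assms by blast
    thus ?thesis using in_I[of x \<gamma>] assms deg by (auto simp: N_def)
  qed
  moreover have "span ?U \<noteq> UNIV"
  proof
    assume U: "span ?U = UNIV"
    have "h = 0" if "h \<in> t" for h
    proof -
      have "h \<in> span ?U" using U by simp
      then obtain S r where S: "finite S" "S \<subseteq> ?U" "h = (\<Sum>a\<in>S. scl (r a) a)"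
        unfolding span_explicit by blast
      have "\<forall>a\<in>S. \<exists>\<delta>. \<delta> \<in> R \<and> a \<in> g \<delta>"
        using S(2) unfolding N_def by blast
      then obtain \<delta> where \<delta>: "\<forall>a\<in>S. \<delta> a \<in> R \<and> a \<in> g (\<delta> a)"
        using bchoice[of S "\<lambda>a \<delta>. \<delta> \<in> R \<and> a \<in> g \<delta>"] by blast
      show ?thesis
        unfolding S(3)
      proof (rule root_vector_sum_in_t[OF S(1), of \<delta> "\<lambda>a. scl (r a) a"])
        show "\<delta> a \<in> R \<and> scl (r a) a \<in> g (\<delta> a)" if "a \<in> S" for a
          using \<delta> that subspace_scale[OF subspace_root_space] by blast
      qed (use that S(3) in simp)
    qed
    hence "x \<in> t" for x using t_self_centralising[of x] br_zero(2) by metis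
    thus False using non_abelian t_commutes by blast
  qed
  ultimately show False by blast
qed

theorem bracket_root_spaces_nonzero:
  assumes "\<gamma> \<in> R" "\<delta> \<in> R" "\<gamma> + \<delta> \<in> R"
  shows "\<exists>x\<in>g \<gamma>. \<exists>y\<in>g \<delta>. br x y \<noteq> 0"
proof -
  obtain e f where "e \<in> g \<gamma>" "f \<in> g (- \<gamma>)" "ev \<gamma> (br e f) \<noteq> 0"
    using nondegenerate_root root_not_degenerate assms(1) by blast
  thus ?thesis using string_value(2)[OF assms] by blast
qed

end

section \<open>Simply-laced root systems\<close>

text \<open>As all roots have squared length \<open>q\<close>, the system is reduced, and on roots the Cartan integers are
  the values of the symmetric bilinear form \<open>2 (x, y) / q\<close>.\<close>

locale simply_laced_root_system =
  fixes \<Delta> B :: "'v::euclidean_space set" and q :: real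
  assumes q_pos: "q > 0"
    and root_norm: "\<gamma> \<in> \<Delta> \<Longrightarrow> \<gamma> \<bullet> \<gamma> = q"
    and reflection_root: "\<gamma> \<in> \<Delta> \<Longrightarrow> \<delta> \<in> \<Delta> \<Longrightarrow> reflection \<gamma> \<delta> \<in> \<Delta>"
    and simple_roots: "simple_system \<Delta> B"
    and roots_span: "span \<Delta> = UNIV"
begin

abbreviation coeff :: "'v \<Rightarrow> 'v \<Rightarrow> real" where
  "coeff x \<beta> \<equiv> representation B x \<beta>"

abbreviation pos :: "'v set" where
  "pos \<equiv> pos_roots \<Delta> B"

definition pairing :: "'v \<Rightarrow> 'v \<Rightarrow> real" where
  "pairing x y = 2 * (x \<bullet> y) / q"

definition height :: "'v \<Rightarrow> real" where
  "height x = (\<Sum>\<beta>\<in>B. coeff x \<beta>)"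

lemma pairing_simps:
  "pairing (x + y) z = pairing x z + pairing y z"
  "pairing (x - y) z = pairing x z - pairing y z"
  "pairing (- x) z = - pairing x z"
  "pairing (r *\<^sub>R x) z = r * pairing x z"
  "pairing z (x + y) = pairing z x + pairing z y"
  "pairing z (x - y) = pairing z x - pairing z y"
  "pairing z (- x) = - pairing z x"
  "pairing z (r *\<^sub>R x) = r * pairing z x"
  by (simp_all add: pairing_def inner_simps add_divide_distrib diff_divide_distrib algebra_simps)

lemma pairing_commute: "pairing x y = pairing y x"
  by (simp add: pairing_def inner_commute)

lemma simple_is_root: "\<beta> \<in> B \<Longrightarrow> \<beta> \<in> \<Delta>"
  and independent_simple: "independent B"
  and root_sign: "\<gamma> \<in> \<Delta> \<Longrightarrow> (\<forall>\<beta>\<in>B. coeff \<gamma> \<beta> \<in> \<nat>) \<or> (\<forall>\<beta>\<in>B. - coeff \<gamma> \<beta> \<in> \<nat>)"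
  using simple_roots unfolding simple_system_def by auto

lemma finite_simple: "finite B"
  using independent_simple by (rule independent_imp_finite)

lemma span_simple: "span B = UNIV"
proof -
  have "span \<Delta> \<subseteq> span B"
    using simple_roots unfolding simple_system_def by (metis span_minimal subspace_span)
  thus ?thesis using roots_span by auto
qed

lemma coeff_simps:
  "coeff (x + y) \<beta> = coeff x \<beta> + coeff y \<beta>"
  "coeff (x - y) \<beta> = coeff x \<beta> - coeff y \<beta>"
  "coeff (- x) \<beta> = - coeff x \<beta>"
  "coeff (r *\<^sub>R x) \<beta> = r * coeff x \<beta>"
  using independent_simple span_simple
  by (simp_all add: representation_add representation_diff representation_neg representation_scale)

lemma coeff_simple: "\<beta> \<in> B \<Longrightarrow> coeff \<beta> \<delta> = (if \<delta> = \<beta> then 1 else 0)"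
  using independent_simple by (simp add: representation_basis)

lemma expansion: "(\<Sum>\<beta>\<in>B. coeff x \<beta> *\<^sub>R \<beta>) = x"
  using independent_simple span_simple finite_simple by (intro sum_representation_eq) auto

lemma pairing_expansion: "pairing x y = (\<Sum>\<beta>\<in>B. coeff y \<beta> * pairing x \<beta>)"
proof -
  have "pairing x y = pairing x (\<Sum>\<beta>\<in>B. coeff y \<beta> *\<^sub>R \<beta>)" by (simp add: expansion)
  also have "\<dots> = (\<Sum>\<beta>\<in>B. coeff y \<beta> * pairing x \<beta>)"
    by (simp add: pairing_def inner_sum_right sum_distrib_left sum_divide_distrib mult_ac)
  finally show ?thesis .
qed

lemma height_simps:
  "height (x + y) = height x + height y"
  "height (x - y) = height x - height y"
  "height (- x) = - height x"
  "height (r *\<^sub>R x) = r * height x"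
  by (simp_all add: height_def coeff_simps sum.distrib sum_subtractf sum_negf sum_distrib_left)

lemma height_simple: "\<beta> \<in> B \<Longrightarrow> height \<beta> = 1"
  using finite_simple by (simp add: height_def coeff_simple)

lemma reflection_pairing: "\<gamma> \<in> \<Delta> \<Longrightarrow> reflection \<gamma> x = x - pairing x \<gamma> *\<^sub>R \<gamma>"
  by (simp add: reflection_def pairing_def root_norm)

lemma pairing_self: "\<gamma> \<in> \<Delta> \<Longrightarrow> pairing \<gamma> \<gamma> = 2"
  using q_pos by (simp add: pairing_def root_norm)

lemma root_nonzero: "\<gamma> \<in> \<Delta> \<Longrightarrow> \<gamma> \<noteq> 0"
  using root_norm q_pos by fastforce

lemma uminus_root: "\<gamma> \<in> \<Delta> \<Longrightarrow> - \<gamma> \<in> \<Delta>"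
  using reflection_root[of \<gamma> \<gamma>] by (simp add: reflection_pairing pairing_self scaleR_2)

lemma coeff_Ints: "\<gamma> \<in> \<Delta> \<Longrightarrow> \<beta> \<in> B \<Longrightarrow> coeff \<gamma> \<beta> \<in> \<int>"
  using root_sign Nats_subset_Ints by (metis Ints_minus add.inverse_inverse subsetD)

text \<open>Subtracting \<open>\<langle>\<gamma>, \<beta>\<rangle> \<beta>\<close> changes the integral coefficient of \<open>\<beta>\<close> to another integer.\<close>

lemma pairing_simple_Ints:
  assumes "\<gamma> \<in> \<Delta>" "\<beta> \<in> B"
  shows "pairing \<gamma> \<beta> \<in> \<int>"
proof -
  have "coeff (reflection \<beta> \<gamma>) \<beta> \<in> \<int>" "coeff \<gamma> \<beta> \<in> \<int>"
    using assms by (simp_all add: coeff_Ints reflection_root simple_is_root)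
  moreover have "coeff (reflection \<beta> \<gamma>) \<beta> = coeff \<gamma> \<beta> - pairing \<gamma> \<beta>"
    using assms by (simp add: reflection_pairing simple_is_root coeff_simps coeff_simple)
  ultimately show ?thesis by (metis Ints_diff diff_diff_eq2 add_diff_cancel_left')
qed

lemma pairing_Ints: "\<gamma> \<in> \<Delta> \<Longrightarrow> \<delta> \<in> \<Delta> \<Longrightarrow> pairing \<gamma> \<delta> \<in> \<int>"
  by (subst pairing_expansion) (intro Ints_sum Ints_mult coeff_Ints pairing_simple_Ints)

lemma pairing_le_1:
  assumes "\<gamma> \<in> \<Delta>" "\<delta> \<in> \<Delta>" "\<gamma> \<noteq> \<delta>"
  shows "pairing \<gamma> \<delta> \<le> 1"
proof -
  have "0 < (\<gamma> - \<delta>) \<bullet> (\<gamma> - \<delta>)" using assms by simp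
  also have "\<dots> = 2 * q - 2 * (\<gamma> \<bullet> \<delta>)"
    using assms by (simp add: inner_simps root_norm inner_commute)
  finally have "pairing \<gamma> \<delta> < 2" using q_pos by (simp add: pairing_def field_simps)
  moreover obtain k :: int where "pairing \<gamma> \<delta> = k"
    using pairing_Ints[OF assms(1,2)] by (auto elim: Ints_cases)
  ultimately show ?thesis by simp
qed

lemma pairing_ge_minus_1:
  assumes "\<gamma> \<in> \<Delta>" "\<delta> \<in> \<Delta>" "\<gamma> \<noteq> - \<delta>"
  shows "pairing \<gamma> \<delta> \<ge> - 1"
  using pairing_le_1[of \<gamma> "- \<delta>"] assms by (simp add: uminus_root pairing_simps)

lemma pairing_pos_eq_1:
  assumes "\<gamma> \<in> \<Delta>" "\<delta> \<in> \<Delta>" "\<gamma> \<noteq> \<delta>" "pairing \<gamma> \<delta> > 0"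
  shows "pairing \<gamma> \<delta> = 1"
proof -
  obtain k :: int where "pairing \<gamma> \<delta> = k"
    using pairing_Ints[OF assms(1,2)] by (auto elim: Ints_cases)
  thus ?thesis using pairing_le_1[OF assms(1-3)] assms(4) by simp
qed

lemma pairing_neg_eq_minus_1:
  assumes "\<gamma> \<in> \<Delta>" "\<delta> \<in> \<Delta>" "\<gamma> \<noteq> - \<delta>" "pairing \<gamma> \<delta> < 0"
  shows "pairing \<gamma> \<delta> = - 1"
  using pairing_pos_eq_1[of \<gamma> "- \<delta>"] assms by (simp add: uminus_root pairing_simps)

lemma diff_root: "\<gamma> \<in> \<Delta> \<Longrightarrow> \<delta> \<in> \<Delta> \<Longrightarrow> pairing \<gamma> \<delta> = 1 \<Longrightarrow> \<gamma> - \<delta> \<in> \<Delta>"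
  using reflection_root[of \<delta> \<gamma>] by (simp add: reflection_pairing)

lemma add_root: "\<gamma> \<in> \<Delta> \<Longrightarrow> \<delta> \<in> \<Delta> \<Longrightarrow> pairing \<gamma> \<delta> = - 1 \<Longrightarrow> \<gamma> + \<delta> \<in> \<Delta>"
  using reflection_root[of \<delta> \<gamma>] by (simp add: reflection_pairing)

lemma pos_root: "\<gamma> \<in> pos \<Longrightarrow> \<gamma> \<in> \<Delta>"
  and coeff_pos_nonneg: "\<gamma> \<in> pos \<Longrightarrow> \<beta> \<in> B \<Longrightarrow> coeff \<gamma> \<beta> \<ge> 0"
  by (auto simp: pos_roots_def)

lemma root_pos_or_neg: "\<gamma> \<in> \<Delta> \<Longrightarrow> \<gamma> \<in> pos \<or> - \<gamma> \<in> pos"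
  using root_sign[of \<gamma>] uminus_root[of \<gamma>]
  by (auto simp: pos_roots_def coeff_simps dest!: Nats_altdef1[THEN equalityD1, THEN subsetD] )

lemma pos_if_coeff:
  assumes "\<gamma> \<in> \<Delta>" "\<beta> \<in> B" "coeff \<gamma> \<beta> > 0"
  shows "\<gamma> \<in> pos"
  using root_pos_or_neg[OF assms(1)] coeff_pos_nonneg[of "- \<gamma>" \<beta>] assms
  by (auto simp: coeff_simps)

lemma pos_not_neg: "\<gamma> \<in> pos \<Longrightarrow> - \<gamma> \<notin> pos"
proof
  assume "\<gamma> \<in> pos" "- \<gamma> \<in> pos"
  hence "\<forall>\<beta>\<in>B. coeff \<gamma> \<beta> = 0"
    using coeff_pos_nonneg[of \<gamma>] coeff_pos_nonneg[of "- \<gamma>"] by (force simp: coeff_simps)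
  hence "\<gamma> = 0" using expansion[of \<gamma>] by simp
  thus False using \<open>\<gamma> \<in> pos\<close> pos_root root_nonzero by blast
qed

lemma simple_pos: "\<beta> \<in> B \<Longrightarrow> \<beta> \<in> pos"
  by (rule pos_if_coeff[of _ \<beta>]) (auto simp: simple_is_root coeff_simple)

lemma height_pos:
  assumes "\<gamma> \<in> pos"
  obtains n where "height \<gamma> = real n" "n > 0"
proof -
  have "height \<gamma> \<in> \<int>"
    unfolding height_def using assms by (intro Ints_sum coeff_Ints pos_root)
  moreover have "height \<gamma> \<ge> 0"
    unfolding height_def using assms by (intro sum_nonneg coeff_pos_nonneg)
  ultimately obtain n where n: "height \<gamma> = real n"
    by (metis Ints_cases of_int_0_le_iff of_nat_nat of_int_of_nat_eq)
  have "n \<noteq> 0"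
  proof
    assume "n = 0"
    hence "\<forall>\<beta>\<in>B. coeff \<gamma> \<beta> = 0"
      using n finite_simple sum_nonneg_eq_0_iff[of B "coeff \<gamma>"] coeff_pos_nonneg[OF assms]
      by (simp add: height_def)
    hence "\<gamma> = 0" using expansion[of \<gamma>] by simp
    thus False using assms pos_root root_nonzero by blast
  qed
  thus thesis using that n by simp
qed

lemma coeff_reflection:
  assumes "\<beta> \<in> B"
  shows "coeff (reflection \<beta> x) \<delta> = (if \<delta> = \<beta> then coeff x \<delta> - pairing x \<beta> else coeff x \<delta>)"
  using assms by (simp add: reflection_pairing simple_is_root coeff_simps coeff_simple)

text \<open>A simple reflection changes only one coefficient, and a positive root other than \<open>\<beta>\<close> has a
  positive coefficient at some other simple root.\<close>

lemma simple_reflection_pos: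
  assumes "\<beta> \<in> B" "\<gamma> \<in> pos" "\<gamma> \<noteq> \<beta>"
  shows "reflection \<beta> \<gamma> \<in> pos"
proof -
  have "\<exists>\<delta>\<in>B. \<delta> \<noteq> \<beta> \<and> coeff \<gamma> \<delta> > 0"
  proof (rule ccontr)
    assume "\<not> ?thesis"
    hence "coeff \<gamma> \<delta> = 0" if "\<delta> \<in> B - {\<beta>}" for \<delta>
      using that coeff_pos_nonneg[OF assms(2)] by force
    hence "\<gamma> = coeff \<gamma> \<beta> *\<^sub>R \<beta>"
      using expansion[of \<gamma>] finite_simple assms(1) by (simp add: sum.remove)
    then obtain c where c: "\<gamma> = c *\<^sub>R \<beta>" "c \<ge> 0"
      using coeff_pos_nonneg[OF assms(2,1)] by metis
    have "c\<^sup>2 * q = q"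
      using c root_norm[OF pos_root[OF assms(2)]] root_norm[OF simple_is_root[OF assms(1)]]
      by (simp add: power2_eq_square)
    hence "c = 1" using q_pos c(2) by (simp add: power2_eq_1_iff)
    thus False using c assms(3) by simp
  qed
  then obtain \<delta> where "\<delta> \<in> B" "\<delta> \<noteq> \<beta>" "coeff \<gamma> \<delta> > 0" by blast
  thus ?thesis
    using assms by (intro pos_if_coeff[of _ \<delta>])
      (auto simp: coeff_reflection intro: reflection_root simple_is_root pos_root)
qed

lemma pairing_simple_nonpos:
  assumes "\<beta> \<in> B" "\<mu> \<in> pos" "coeff \<mu> \<beta> = 0"
  shows "pairing \<mu> \<beta> \<le> 0"
proof -
  have "\<mu> \<noteq> \<beta>" using assms by (auto simp: coeff_simple)
  hence "coeff (reflection \<beta> \<mu>) \<beta> \<ge> 0"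
    using assms simple_reflection_pos coeff_pos_nonneg by blast
  thus ?thesis using assms by (simp add: coeff_reflection)
qed

text \<open>Since \<open>\<langle>\<gamma>, \<gamma>\<rangle> = 2\<close> is a nonnegative combination of the numbers \<open>\<langle>\<gamma>, \<beta>\<rangle>\<close>, one of them is
  positive.\<close>

lemma descent:
  assumes "\<gamma> \<in> pos" "\<gamma> \<notin> B"
  obtains \<beta> where "\<beta> \<in> B" "reflection \<beta> \<gamma> = \<gamma> - \<beta>" "\<gamma> - \<beta> \<in> pos"
proof -
  have "\<exists>\<beta>\<in>B. pairing \<gamma> \<beta> > 0"
  proof (rule ccontr)
    assume "\<not> ?thesis"
    hence "pairing \<gamma> \<gamma> \<le> 0"
      unfolding pairing_expansion[of \<gamma> \<gamma>]
      by (intro sum_nonpos mult_nonneg_nonpos) (auto intro: coeff_pos_nonneg[OF assms(1)])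
    thus False using assms pairing_self pos_root by fastforce
  qed
  then obtain \<beta> where b: "\<beta> \<in> B" "pairing \<gamma> \<beta> > 0" by blast
  hence "pairing \<gamma> \<beta> = 1"
    using assms by (intro pairing_pos_eq_1) (auto intro: pos_root simple_is_root)
  hence "reflection \<beta> \<gamma> = \<gamma> - \<beta>" using b by (simp add: reflection_pairing simple_is_root)
  thus thesis using that b simple_reflection_pos assms by metis
qed

lemma pos_height_induct [consumes 1, case_names step]:
  assumes "\<gamma> \<in> pos"
    and step: "\<And>\<gamma>. \<gamma> \<in> pos \<Longrightarrow> (\<And>\<delta>. \<delta> \<in> pos \<Longrightarrow> height \<delta> < height \<gamma> \<Longrightarrow> P \<delta>) \<Longrightarrow> P \<gamma>"
  shows "P \<gamma>"
proof -
  obtain n where "height \<gamma> = real n" using height_pos[OF assms(1)] by blast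
  thus ?thesis using assms(1)
  proof (induction n arbitrary: \<gamma> rule: less_induct)
    case (less n)
    show ?case
    proof (rule step)
      fix \<delta> assume d: "\<delta> \<in> pos" "height \<delta> < height \<gamma>"
      obtain m where "height \<delta> = real m" using height_pos[OF d(1)] by blast
      thus "P \<delta>" using less d by auto
    qed (fact less)
  qed
qed

text \<open>On the way down to a simple root from one with larger coefficient, the coefficient drops from two
  to one when \<open>\<alpha>\<close> is subtracted from some root \<open>\<gamma>\<close>; then \<open>\<gamma> - \<alpha>\<close> and \<open>\<alpha>\<close> have a root as their sum.\<close>

lemma coeff_le_1_if_sums_not_roots:
  assumes "\<alpha> \<in> B"
    and sums: "\<And>\<gamma> \<delta>. \<gamma> \<in> nilradical_roots \<Delta> B \<alpha> \<Longrightarrow> \<delta> \<in> nilradical_roots \<Delta> B \<alpha> \<Longrightarrow> \<gamma> + \<delta> \<notin> \<Delta>"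
    and "\<gamma> \<in> pos"
  shows "coeff \<gamma> \<alpha> \<le> 1"
  using \<open>\<gamma> \<in> pos\<close>
proof (induction rule: pos_height_induct)
  case (step \<gamma>)
  show ?case
  proof (cases "\<gamma> \<in> B")
    case True
    thus ?thesis by (simp add: coeff_simple)
  next
    case False
    then obtain \<beta> where b: "\<beta> \<in> B" "\<gamma> - \<beta> \<in> pos"
      using descent step by metis
    have IH: "coeff (\<gamma> - \<beta>) \<alpha> \<le> 1"
      using step b by (simp add: height_simps height_simple)
    show ?thesis
    proof (cases "\<beta> = \<alpha>")
      case True
      have "coeff (\<gamma> - \<alpha>) \<alpha> < 1"
      proof (rule ccontr)
        assume "\<not> ?thesis"
        hence "\<gamma> - \<alpha> \<in> nilradical_roots \<Delta> B \<alpha>"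
          using b True by (simp add: nilradical_roots_def)
        moreover have "\<alpha> \<in> nilradical_roots \<Delta> B \<alpha>"
          using assms(1) by (simp add: nilradical_roots_def simple_pos coeff_simple)
        ultimately show False using sums[of "\<gamma> - \<alpha>" \<alpha>] step.hyps pos_root by simp
      qed
      moreover obtain k :: int where "coeff (\<gamma> - \<alpha>) \<alpha> = k"
        using coeff_Ints[of "\<gamma> - \<alpha>" \<alpha>] b assms(1) True pos_root by (metis Ints_cases)
      ultimately have "coeff (\<gamma> - \<alpha>) \<alpha> \<le> 0" by simp
      thus ?thesis using assms(1) by (simp add: coeff_simps coeff_simple)
    qed (use IH b in \<open>simp add: coeff_simps coeff_simple\<close>)
  qed
qed

section \<open>Words of minimal length\<close>

text \<open>The fold is the one in the definition of \<^const>\<open>weyl_length\<close>; the last letter acts first.\<close>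

definition word :: "'v list \<Rightarrow> 'v \<Rightarrow> 'v" where
  "word bs = foldr (\<lambda>\<beta> u. reflection \<beta> \<circ> u) bs id"

lemma word_Nil [simp]: "word [] x = x"
  and word_Cons [simp]: "word (\<beta> # bs) x = reflection \<beta> (word bs x)"
  by (simp_all add: word_def)

lemma word_append: "word (bs @ cs) x = word bs (word cs x)"
  by (induction bs) simp_all

lemma reflection_reflection: "\<gamma> \<in> \<Delta> \<Longrightarrow> reflection \<gamma> (reflection \<gamma> x) = x"
  by (simp add: reflection_pairing pairing_simps pairing_self algebra_simps)

lemma pairing_reflection: "\<gamma> \<in> \<Delta> \<Longrightarrow> pairing (reflection \<gamma> x) (reflection \<gamma> y) = pairing x y"
  by (simp add: reflection_pairing pairing_simps pairing_self pairing_commute algebra_simps)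

lemma reflection_uminus: "\<gamma> \<in> \<Delta> \<Longrightarrow> reflection \<gamma> (- x) = - reflection \<gamma> x"
  by (simp add: reflection_pairing pairing_simps)

lemma reflection_conjugate:
  assumes "\<gamma> \<in> \<Delta>" "\<delta> \<in> \<Delta>"
  shows "reflection (reflection \<gamma> \<delta>) x = reflection \<gamma> (reflection \<delta> (reflection \<gamma> x))"
proof -
  have "pairing x (reflection \<gamma> \<delta>) = pairing (reflection \<gamma> x) \<delta>"
    using pairing_reflection[OF assms(1), of "reflection \<gamma> x" \<delta>]
    by (simp add: reflection_reflection assms(1))
  moreover have "reflection \<gamma> (y - c *\<^sub>R \<delta>) = reflection \<gamma> y - c *\<^sub>R reflection \<gamma> \<delta>" for y c
    using assms by (simp add: reflection_pairing pairing_simps algebra_simps)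
  ultimately show ?thesis
    using assms by (simp add: reflection_pairing[of "reflection \<gamma> \<delta>"] reflection_pairing[OF assms(2)]
        reflection_root reflection_reflection)
qed

lemma pairing_word: "set bs \<subseteq> B \<Longrightarrow> pairing (word bs x) (word bs y) = pairing x y"
  by (induction bs) (simp_all add: pairing_reflection simple_is_root)

lemma word_root: "set bs \<subseteq> B \<Longrightarrow> \<gamma> \<in> \<Delta> \<Longrightarrow> word bs \<gamma> \<in> \<Delta>"
  by (induction bs) (simp_all add: reflection_root simple_is_root)

lemma word_uminus: "set bs \<subseteq> B \<Longrightarrow> word bs (- x) = - word bs x"
  by (induction bs) (simp_all add: reflection_uminus simple_is_root)

lemma word_inj: "set bs \<subseteq> B \<Longrightarrow> word bs x = word bs y \<Longrightarrow> x = y"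
  by (induction bs) (auto dest: arg_cong[where f = "reflection _"] simp: reflection_reflection simple_is_root,
      metis reflection_reflection simple_is_root)

lemma coeff_word: "set bs \<subseteq> B - {\<alpha>} \<Longrightarrow> coeff (word bs x) \<alpha> = coeff x \<alpha>"
  by (induction bs) (auto simp: coeff_reflection)

lemma word_in_weyl_group: "set bs \<subseteq> B \<Longrightarrow> word bs \<in> weyl_group \<Delta>"
  by (induction bs) (auto simp: word_def id_def[symmetric] intro: weyl_group.intros simple_is_root)

text \<open>Induction on the height: the reflection in \<open>\<gamma>\<close> is conjugate under \<open>\<sigma>\<^sub>\<beta>\<close> to the reflection in the
  lower root \<open>\<gamma> - \<beta>\<close>.\<close>

lemma reflection_is_word:
  assumes "\<gamma> \<in> pos"
  shows "\<exists>bs. set bs \<subseteq> B \<and> reflection \<gamma> = word bs"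
  using assms
proof (induction rule: pos_height_induct)
  case (step \<gamma>)
  show ?case
  proof (cases "\<gamma> \<in> B")
    case True
    thus ?thesis by (intro exI[of _ "[\<gamma>]"]) auto
  next
    case False
    then obtain \<beta> where b: "\<beta> \<in> B" "reflection \<beta> \<gamma> = \<gamma> - \<beta>" "\<gamma> - \<beta> \<in> pos"
      using descent step by metis
    then obtain bs where bs: "set bs \<subseteq> B" "reflection (\<gamma> - \<beta>) = word bs"
      using step.IH[of "\<gamma> - \<beta>"] by (auto simp: height_simps height_simple)
    have "reflection \<gamma> x = reflection \<beta> (reflection (\<gamma> - \<beta>) (reflection \<beta> x))" for x
      using reflection_conjugate[of \<beta> "reflection \<beta> \<gamma>" x] b
      by (metis pos_root reflection_reflection simple_is_root)
    hence "reflection \<gamma> = word (\<beta> # bs @ [\<beta>])"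
      by (simp add: fun_eq_iff bs word_append)
    thus ?thesis using b bs by (intro exI[of _ "\<beta> # bs @ [\<beta>]"]) auto
  qed
qed

lemma weyl_group_is_word:
  assumes "w \<in> weyl_group \<Delta>"
  shows "\<exists>bs. set bs \<subseteq> B \<and> w = word bs"
  using assms
proof induction
  case id
  show ?case by (intro exI[of _ "[]"]) auto
next
  case (reflection \<gamma> w)
  have "reflection (- \<gamma>) = reflection \<gamma>" by (simp add: reflection_def fun_eq_iff)
  then obtain cs where "set cs \<subseteq> B" "reflection \<gamma> = word cs"
    using reflection_is_word root_pos_or_neg[OF reflection.hyps(1)] by metis
  moreover obtain bs where "set bs \<subseteq> B" "w = word bs" using reflection.IH by blast
  ultimately show ?case
    by (intro exI[of _ "cs @ bs"]) (auto simp: word_append)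
qed

text \<open>The absolute value is needed because \<open>\<sigma>\<^sub>\<beta>\<close> sends \<open>\<beta>\<close> to \<open>-\<beta>\<close>, which lowers the height by two.\<close>

lemma abs_height_reflection:
  assumes "\<gamma> \<in> \<Delta>" "\<beta> \<in> B"
  shows "\<bar>height (reflection \<beta> \<gamma>)\<bar> \<ge> \<bar>height \<gamma>\<bar> - 1"
proof (cases "\<gamma> = \<beta> \<or> \<gamma> = - \<beta>")
  case True
  thus ?thesis
    using assms by (auto simp: reflection_pairing simple_is_root pairing_self pairing_simps height_simps height_simple)
next
  case False
  hence "\<bar>pairing \<gamma> \<beta>\<bar> \<le> 1"
    using pairing_le_1[of \<gamma> \<beta>] pairing_ge_minus_1[of \<gamma> \<beta>] assms simple_is_root by auto
  thus ?thesis
    using assms by (simp add: reflection_pairing simple_is_root height_simps height_simple)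
qed

lemma abs_height_word:
  "set bs \<subseteq> B \<Longrightarrow> \<gamma> \<in> \<Delta> \<Longrightarrow> \<bar>height (word bs \<gamma>)\<bar> \<ge> \<bar>height \<gamma>\<bar> - length bs"
proof (induction bs)
  case (Cons \<beta> bs)
  thus ?case using abs_height_reflection[of "word bs \<gamma>" \<beta>] by (simp add: word_root)
qed simp

text \<open>A word of length at most \<open>height \<gamma> - 1\<close> reaches a root of height one from \<open>\<gamma>\<close> only if every
  letter lowers the height.  The following lemmas read off the consequences letter by letter,
  starting with the letter that acts first.\<close>

lemma minimal_word_descent:
  assumes "set (bs @ [\<beta>]) \<subseteq> B" "\<gamma> \<in> pos" "word (bs @ [\<beta>]) \<gamma> \<in> B"
    and len: "real (length (bs @ [\<beta>])) \<le> height \<gamma> - 1"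
  shows "reflection \<beta> \<gamma> = \<gamma> - \<beta>" "\<gamma> - \<beta> \<in> pos" "pairing \<gamma> \<beta> = 1"
    "real (length bs) \<le> height (\<gamma> - \<beta>) - 1" "word bs (\<gamma> - \<beta>) = word (bs @ [\<beta>]) \<gamma>"
proof -
  have b: "\<beta> \<in> B" and bs: "set bs \<subseteq> B" using assms by auto
  have bound: "\<bar>height (reflection \<beta> \<gamma>)\<bar> \<le> 1 + real (length bs)"
    using abs_height_word[OF bs, of "reflection \<beta> \<gamma>"] assms b
    by (simp add: word_append reflection_root pos_root simple_is_root height_simple)
  have ne: "\<gamma> \<noteq> \<beta>"
    using len by (auto simp: height_simple[OF b])
  have pos': "reflection \<beta> \<gamma> \<in> pos"
    using simple_reflection_pos b ne assms(2) by blast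
  have "height (reflection \<beta> \<gamma>) = height \<gamma> - pairing \<gamma> \<beta>"
    using b by (simp add: reflection_pairing simple_is_root height_simps height_simple)
  moreover have "pairing \<gamma> \<beta> \<le> 1"
    using pairing_le_1 ne assms(2) b pos_root simple_is_root by blast
  ultimately show p: "pairing \<gamma> \<beta> = 1" using bound len by simp
  show r: "reflection \<beta> \<gamma> = \<gamma> - \<beta>" using p b by (simp add: reflection_pairing simple_is_root)
  show "\<gamma> - \<beta> \<in> pos" using pos' r by simp
  show "real (length bs) \<le> height (\<gamma> - \<beta>) - 1"
    using len b by (simp add: height_simps height_simple)
  show "word bs (\<gamma> - \<beta>) = word (bs @ [\<beta>]) \<gamma>" using r by (simp add: word_append)
qed

lemma minimal_word_coeff:
  assumes "set bs \<subseteq> B" "\<gamma> \<in> pos" "word bs \<gamma> = \<alpha>" "\<alpha> \<in> B" "real (length bs) \<le> height \<gamma> - 1"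
  shows "coeff \<gamma> \<alpha> \<ge> 1"
  using assms
proof (induction bs arbitrary: \<gamma> rule: rev_induct)
  case Nil
  thus ?case by (simp add: coeff_simple)
next
  case (snoc \<beta> bs)
  have "coeff (\<gamma> - \<beta>) \<alpha> \<ge> 1"
    using minimal_word_descent[of bs \<beta> \<gamma>] snoc by simp
  thus ?case using snoc.prems by (simp add: coeff_simps coeff_simple split: if_splits)
qed

text \<open>The coefficient of \<open>\<alpha>\<close> cannot increase along the way and ends at one, so if it begins at
  one the letter \<open>\<alpha>\<close> never occurs.\<close>

lemma minimal_word_avoids:
  assumes "set bs \<subseteq> B" "\<gamma> \<in> pos" "word bs \<gamma> = \<alpha>" "\<alpha> \<in> B" "real (length bs) \<le> height \<gamma> - 1"
    and "coeff \<gamma> \<alpha> \<le> 1"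
  shows "set bs \<subseteq> B - {\<alpha>}"
  using assms
proof (induction bs arbitrary: \<gamma> rule: rev_induct)
  case (snoc \<beta> bs)
  note d = minimal_word_descent[of bs \<beta> \<gamma>]
  have "coeff (\<gamma> - \<beta>) \<alpha> \<ge> 1"
    using d snoc.prems by (intro minimal_word_coeff[of bs]) simp_all
  hence "\<beta> \<noteq> \<alpha>" using snoc.prems by (auto simp: coeff_simps coeff_simple)
  moreover have "set bs \<subseteq> B - {\<alpha>}"
    using d snoc.prems by (intro snoc.IH[of "\<gamma> - \<beta>"]) (auto simp: coeff_simps coeff_simple)
  ultimately show ?case using snoc.prems by simp
qed simp

text \<open>A positive root becomes negative at the moment when it equals the acting letter \<open>\<beta>\<close>; there the
  current image of \<open>\<gamma>\<close> has pairing one with \<open>\<beta>\<close>, and reflections preserve the pairing.\<close>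

lemma minimal_word_negates:
  assumes "set bs \<subseteq> B" "\<gamma> \<in> pos" "word bs \<gamma> \<in> B" "real (length bs) \<le> height \<gamma> - 1"
    and "\<mu> \<in> pos" "- word bs \<mu> \<in> pos"
  shows "pairing \<mu> \<gamma> > 0"
  using assms
proof (induction bs arbitrary: \<gamma> \<mu> rule: rev_induct)
  case Nil
  thus ?case using pos_not_neg by auto
next
  case (snoc \<beta> bs)
  note d = minimal_word_descent[of bs \<beta> \<gamma>]
  show ?case
  proof (cases "\<mu> = \<beta>")
    case True
    thus ?thesis using d snoc.prems by (simp add: pairing_commute)
  next
    case False
    have "pairing (reflection \<beta> \<mu>) (\<gamma> - \<beta>) > 0"
      using d snoc.prems False
      by (intro snoc.IH) (simp_all add: simple_reflection_pos word_append)
    thus ?thesis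
      using d snoc.prems pairing_reflection[of \<beta> \<mu> \<gamma>] by (simp add: simple_is_root)
  qed
qed

lemma weyl_length_le: "set bs \<subseteq> B \<Longrightarrow> weyl_length B (word bs) \<le> length bs"
  unfolding weyl_length_def word_def by (rule Least_le) blast

lemma weyl_length_word:
  assumes "w \<in> weyl_group \<Delta>"
  shows "\<exists>bs. set bs \<subseteq> B \<and> length bs = weyl_length B w \<and> w = word bs"
proof -
  obtain cs where "set cs \<subseteq> B" "w = word cs" using weyl_group_is_word assms by blast
  hence "\<exists>bs. set bs \<subseteq> B \<and> length bs = length cs \<and> w = foldr (\<lambda>\<beta> u. reflection \<beta> \<circ> u) bs id"
    by (auto simp: word_def)
  thus ?thesis unfolding weyl_length_def word_def
    by (rule LeastI[where P = "\<lambda>n. \<exists>bs. set bs \<subseteq> B \<and> length bs = n \<and> w = foldr (\<lambda>\<beta> u. reflection \<beta> \<circ> u) bs id"])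
qed

end

section \<open>Inversion sets for a cominuscule simple root\<close>

locale cominuscule_simple_root = simply_laced_root_system +
  fixes \<alpha>
  assumes alpha_simple: "\<alpha> \<in> B"
    and coeff_alpha_le_1: "\<gamma> \<in> pos \<Longrightarrow> coeff \<gamma> \<alpha> \<le> 1"
begin

abbreviation nilroots :: "'a set" where
  "nilroots \<equiv> nilradical_roots \<Delta> B \<alpha>"

lemma nilroot_iff: "\<gamma> \<in> nilroots \<longleftrightarrow> \<gamma> \<in> \<Delta> \<and> coeff \<gamma> \<alpha> = 1"
  using coeff_alpha_le_1[of \<gamma>] pos_if_coeff[of \<gamma> \<alpha>] alpha_simple
  by (auto simp: nilradical_roots_def pos_root)

lemma nilroot_pos: "\<gamma> \<in> nilroots \<Longrightarrow> \<gamma> \<in> pos"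
  by (simp add: nilradical_roots_def)

lemma alpha_nilroot: "\<alpha> \<in> nilroots"
  using alpha_simple by (simp add: nilroot_iff simple_is_root coeff_simple)

lemma pos_cases: "\<mu> \<in> pos \<Longrightarrow> \<mu> \<in> nilroots \<or> coeff \<mu> \<alpha> = 0"
proof -
  assume m: "\<mu> \<in> pos"
  obtain k :: int where "coeff \<mu> \<alpha> = k"
    using coeff_Ints[OF pos_root[OF m] alpha_simple] by (metis Ints_cases)
  thus ?thesis
    using coeff_alpha_le_1[OF m] coeff_pos_nonneg[OF m alpha_simple] pos_root[OF m]
    by (auto simp: nilroot_iff)
qed

lemma nilroot_reflection: "\<beta> \<in> B - {\<alpha>} \<Longrightarrow> \<gamma> \<in> nilroots \<Longrightarrow> reflection \<beta> \<gamma> \<in> nilroots"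
  by (auto simp: nilroot_iff coeff_reflection reflection_root simple_is_root)

text \<open>Otherwise the sum of the two roots would be a root in which \<open>\<alpha>\<close> has coefficient two.\<close>

lemma nilroot_pairing_nonneg:
  assumes "\<gamma> \<in> nilroots" "\<delta> \<in> nilroots"
  shows "pairing \<gamma> \<delta> \<ge> 0"
proof (rule ccontr)
  assume "\<not> ?thesis"
  moreover have "\<gamma> \<noteq> - \<delta>" using assms by (auto simp: nilroot_iff coeff_simps)
  ultimately have "\<gamma> + \<delta> \<in> \<Delta>"
    using assms by (auto intro!: add_root pairing_neg_eq_minus_1 simp: nilroot_iff)
  moreover have "coeff (\<gamma> + \<delta>) \<alpha> = 2" using assms by (simp add: nilroot_iff coeff_simps)
  ultimately show False
    using coeff_alpha_le_1[of "\<gamma> + \<delta>"] pos_if_coeff[of "\<gamma> + \<delta>" \<alpha>] alpha_simple by simp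
qed

lemma nilroot_pairing_cases:
  assumes "\<gamma> \<in> nilroots" "\<delta> \<in> nilroots" "\<gamma> \<noteq> \<delta>"
  shows "pairing \<gamma> \<delta> = 0 \<or> pairing \<gamma> \<delta> = 1"
  using assms nilroot_pairing_nonneg[of \<gamma> \<delta>] pairing_pos_eq_1[of \<gamma> \<delta>]
  by (cases "pairing \<gamma> \<delta> = 0") (simp_all add: nilroot_iff)

text \<open>In \<open>\<langle>\<gamma>, \<gamma>\<rangle> = 2\<close> the contribution of \<open>\<alpha>\<close> is \<open>\<langle>\<gamma>, \<alpha>\<rangle> \<le> 1\<close>, so some other simple root contributes
  positively.\<close>

lemma nilroot_descent:
  assumes "\<gamma> \<in> nilroots" "\<gamma> \<noteq> \<alpha>"
  obtains \<beta> where "\<beta> \<in> B - {\<alpha>}" "reflection \<beta> \<gamma> = \<gamma> - \<beta>" "\<gamma> - \<beta> \<in> nilroots" "pairing \<gamma> \<beta> = 1"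
proof -
  have "\<exists>\<beta>\<in>B - {\<alpha>}. pairing \<gamma> \<beta> > 0"
  proof (rule ccontr)
    assume "\<not> ?thesis"
    hence "(\<Sum>\<beta>\<in>B - {\<alpha>}. coeff \<gamma> \<beta> * pairing \<gamma> \<beta>) \<le> 0"
      by (intro sum_nonpos mult_nonneg_nonpos) (auto intro: coeff_pos_nonneg[OF nilroot_pos[OF assms(1)]] simp: not_less)
    moreover have "pairing \<gamma> \<gamma> = pairing \<gamma> \<alpha> + (\<Sum>\<beta>\<in>B - {\<alpha>}. coeff \<gamma> \<beta> * pairing \<gamma> \<beta>)"
      unfolding pairing_expansion[of \<gamma> \<gamma>]
      using assms finite_simple alpha_simple by (simp add: sum.remove nilroot_iff)
    moreover have "pairing \<gamma> \<gamma> = 2" "pairing \<gamma> \<alpha> \<le> 1"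
      using assms alpha_nilroot by (auto simp: nilroot_iff pairing_self intro: pairing_le_1)
    ultimately show False by simp
  qed
  then obtain \<beta> where b: "\<beta> \<in> B - {\<alpha>}" "pairing \<gamma> \<beta> > 0" by blast
  have "\<gamma> \<noteq> \<beta>" using b assms by (auto simp: nilroot_iff coeff_simple)
  hence p: "pairing \<gamma> \<beta> = 1"
    using assms b by (intro pairing_pos_eq_1) (auto simp: nilroot_iff simple_is_root)
  hence "reflection \<beta> \<gamma> = \<gamma> - \<beta>" using b by (simp add: reflection_pairing simple_is_root)
  thus thesis using that b p nilroot_reflection assms by metis
qed

lemma nilroot_height_induct [consumes 1, case_names alpha descend]:
  assumes "\<gamma> \<in> nilroots"
    and "P \<alpha>"
    and step: "\<And>\<gamma> \<beta>. \<gamma> \<in> nilroots \<Longrightarrow> \<beta> \<in> B - {\<alpha>} \<Longrightarrow> reflection \<beta> \<gamma> = \<gamma> - \<beta> \<Longrightarrow> \<gamma> - \<beta> \<in> nilroots \<Longrightarrow>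
      pairing \<gamma> \<beta> = 1 \<Longrightarrow> P (\<gamma> - \<beta>) \<Longrightarrow> P \<gamma>"
  shows "P \<gamma>"
  using nilroot_pos[OF assms(1)] assms(1)
proof (induction rule: pos_height_induct)
  case (step \<gamma>)
  show ?case
  proof (cases "\<gamma> = \<alpha>")
    case False
    then obtain \<beta> where "\<beta> \<in> B - {\<alpha>}" "reflection \<beta> \<gamma> = \<gamma> - \<beta>" "\<gamma> - \<beta> \<in> nilroots" "pairing \<gamma> \<beta> = 1"
      using nilroot_descent step by metis
    moreover from this have "P (\<gamma> - \<beta>)"
      by (intro step.IH) (auto simp: nilroot_pos height_simps height_simple)
    ultimately show ?thesis using assms(3) step by blast
  qed (simp add: assms)
qed

lemma descending_word:
  assumes "\<gamma> \<in> nilroots"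
  shows "\<exists>bs. set bs \<subseteq> B \<and> word bs \<gamma> = \<alpha> \<and> real (length bs) = height \<gamma> - 1"
  using assms
proof (induction rule: nilroot_height_induct)
  case alpha
  show ?case by (intro exI[of _ "[]"]) (simp add: height_simple alpha_simple)
next
  case (descend \<gamma> \<beta>)
  then obtain bs where "set bs \<subseteq> B" "word bs (\<gamma> - \<beta>) = \<alpha>" "real (length bs) = height (\<gamma> - \<beta>) - 1"
    by blast
  thus ?case using descend
    by (intro exI[of _ "bs @ [\<beta>]"]) (simp add: word_append height_simps height_simple)
qed

text \<open>\<open>descending_word\<close> bounds the minimal length by \<open>height \<gamma> - 1\<close>, so whichever minimal element is
  chosen has a word to which the lemmas on minimal words apply.\<close>

lemma shortest_to_word:
  assumes "\<gamma> \<in> nilroots"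
  obtains bs where "set bs \<subseteq> B" "shortest_to \<Delta> B \<gamma> \<alpha> = word bs" "word bs \<gamma> = \<alpha>"
    "real (length bs) \<le> height \<gamma> - 1"
proof -
  define w where "w = shortest_to \<Delta> B \<gamma> \<alpha>"
  obtain cs where cs: "set cs \<subseteq> B" "word cs \<gamma> = \<alpha>" "real (length cs) = height \<gamma> - 1"
    using descending_word[OF assms] by blast
  have c: "word cs \<in> weyl_group \<Delta> \<and> word cs \<gamma> = \<alpha>"
    using cs by (simp add: word_in_weyl_group)
  have w: "w \<in> weyl_group \<Delta>" "w \<gamma> = \<alpha>" "weyl_length B w \<le> weyl_length B (word cs)"
    using arg_min_nat_lemma[where P = "\<lambda>w. w \<in> weyl_group \<Delta> \<and> w \<gamma> = \<alpha>" and m = "weyl_length B", OF c] c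
    unfolding w_def shortest_to_def by auto
  obtain bs where "set bs \<subseteq> B" "length bs = weyl_length B w" "w = word bs"
    using weyl_length_word[OF w(1)] by blast
  thus thesis using that[of bs] w cs weyl_length_le[OF cs(1)] by (simp add: w_def)
qed

text \<open>Let \<open>w\<close> be the chosen element.  It preserves the coefficient of \<open>\<alpha>\<close>, so it inverts only roots
  \<open>\<mu>\<close> in which this coefficient is zero.  For these, \<open>\<langle>\<mu>, \<gamma>\<rangle> > 0\<close> is necessary by
  \<open>minimal_word_negates\<close>; it is sufficient because \<open>\<langle>w \<mu>, \<alpha>\<rangle> = \<langle>\<mu>, \<gamma>\<rangle>\<close>, whereas a positive root
  without \<open>\<alpha>\<close> has nonpositive pairing with \<open>\<alpha>\<close>.  The final reflection in \<open>\<alpha>\<close> then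
  changes the sign only of \<open>\<plusminus>\<alpha>\<close>, that is, of the image of \<open>\<plusminus>\<gamma>\<close>.\<close>

lemma inversions_shortest_to:
  assumes "\<gamma> \<in> nilroots"
  shows "inversions \<Delta> B (reflection \<alpha> \<circ> shortest_to \<Delta> B \<gamma> \<alpha>) =
    {\<gamma>} \<union> {\<mu> \<in> pos. coeff \<mu> \<alpha> = 0 \<and> pairing \<mu> \<gamma> > 0}"
proof -
  obtain bs where bs: "set bs \<subseteq> B" "shortest_to \<Delta> B \<gamma> \<alpha> = word bs" "word bs \<gamma> = \<alpha>"
    "real (length bs) \<le> height \<gamma> - 1"
    using shortest_to_word[OF assms] by blast
  have avoid: "set bs \<subseteq> B - {\<alpha>}"
    using bs assms alpha_simple nilroot_pos by (intro minimal_word_avoids[of bs \<gamma>]) (auto simp: nilroot_iff)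
  have neg: "- word bs \<mu> \<in> pos \<longleftrightarrow> coeff \<mu> \<alpha> = 0 \<and> pairing \<mu> \<gamma> > 0" if m: "\<mu> \<in> pos" for \<mu>
  proof (cases "coeff \<mu> \<alpha> = 0")
    case True
    have "pairing \<mu> \<gamma> \<le> 0" if "word bs \<mu> \<in> pos"
      using pairing_simple_nonpos[OF alpha_simple that] coeff_word[OF avoid] True
        pairing_word[OF bs(1), of \<mu> \<gamma>] bs(3) by simp
    moreover have "word bs \<mu> \<in> pos \<or> - word bs \<mu> \<in> pos"
      using root_pos_or_neg word_root bs(1) m pos_root by blast
    moreover have "pairing \<mu> \<gamma> > 0" if "- word bs \<mu> \<in> pos"
      using minimal_word_negates[of bs \<gamma> \<mu>] that bs m nilroot_pos[OF assms] alpha_simple by simp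
    ultimately show ?thesis using True by force
  next
    case False
    hence "coeff \<mu> \<alpha> = 1" using pos_cases[OF m] by (simp add: nilroot_iff)
    hence "\<not> - word bs \<mu> \<in> pos"
      using coeff_pos_nonneg[of "- word bs \<mu>" \<alpha>] alpha_simple coeff_word[OF avoid, of \<mu>]
      by (auto simp: coeff_simps)
    thus ?thesis using False by simp
  qed
  have "- reflection \<alpha> (word bs \<mu>) \<in> pos \<longleftrightarrow> \<mu> = \<gamma> \<or> - word bs \<mu> \<in> pos" if m: "\<mu> \<in> pos" for \<mu>
  proof -
    have a: "\<alpha> \<in> \<Delta>" using alpha_simple by (rule simple_is_root)
    have ra: "reflection \<alpha> \<alpha> = - \<alpha>"
      using a by (simp add: reflection_pairing pairing_self scaleR_2)
    have "word bs \<mu> \<in> pos \<or> - word bs \<mu> \<in> pos"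
      using root_pos_or_neg word_root bs(1) m pos_root by blast
    thus ?thesis
    proof
      assume p: "word bs \<mu> \<in> pos"
      show ?thesis
      proof (cases "word bs \<mu> = \<alpha>")
        case True
        hence "\<mu> = \<gamma>" using word_inj[OF bs(1)] bs(3) by simp
        thus ?thesis using True ra simple_pos[OF alpha_simple] by simp
      next
        case False
        hence "reflection \<alpha> (word bs \<mu>) \<in> pos" using simple_reflection_pos alpha_simple p by blast
        thus ?thesis using False p bs(3) pos_not_neg by blast
      qed
    next
      assume p: "- word bs \<mu> \<in> pos"
      have "- word bs \<mu> \<noteq> \<alpha>"
      proof
        assume "- word bs \<mu> = \<alpha>"
        hence "word bs (- \<mu>) = word bs \<gamma>" using bs by (simp add: word_uminus)
        hence "- \<mu> = \<gamma>" using word_inj[OF bs(1)] by blast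
        thus False using pos_not_neg m nilroot_pos[OF assms] by blast
      qed
      hence "reflection \<alpha> (- word bs \<mu>) \<in> pos" using simple_reflection_pos alpha_simple p by blast
      thus ?thesis using p a by (simp add: reflection_uminus)
    qed
  qed
  hence "- reflection \<alpha> (word bs \<mu>) \<in> pos \<longleftrightarrow> \<mu> = \<gamma> \<or> coeff \<mu> \<alpha> = 0 \<and> pairing \<mu> \<gamma> > 0"
    if "\<mu> \<in> pos" for \<mu>
    using that neg by blast
  thus ?thesis
    unfolding inversions_def bs(2) comp_def using nilroot_pos[OF assms] by blast
qed

lemma inversion_nilroot_iff:
  assumes "\<gamma> \<in> nilroots" "\<delta> \<in> nilroots"
  shows "\<gamma> \<in> inversions \<Delta> B (reflection \<alpha> \<circ> shortest_to \<Delta> B \<delta> \<alpha>) \<longleftrightarrow> \<gamma> = \<delta>"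
  using assms by (auto simp: inversions_shortest_to nilroot_iff)

text \<open>Distinct \<open>\<gamma>\<close> give distinct members of the family, as each member inverts its own \<open>\<gamma>\<close> and no
  other root of the nilradical.  Counting members is therefore counting roots \<open>\<gamma>\<close>.\<close>

lemma Ess_nilradical_family:
  "Ess \<Delta> B (nilradical_family \<Delta> B \<alpha>) =
    nilroots \<union> {\<mu> \<in> pos. coeff \<mu> \<alpha> = 0 \<and> (\<exists>!\<gamma>. \<gamma> \<in> nilroots \<and> pairing \<mu> \<gamma> > 0)}"
proof -
  define f where "f \<gamma> = reflection \<alpha> \<circ> shortest_to \<Delta> B \<gamma> \<alpha>" for \<gamma>
  have fam: "nilradical_family \<Delta> B \<alpha> = f ` nilroots"
    by (auto simp: nilradical_family_def f_def)
  have inj: "\<gamma> = \<delta>" if "\<gamma> \<in> nilroots" "\<delta> \<in> nilroots" "f \<gamma> = f \<delta>" for \<gamma> \<delta>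
    using inversion_nilroot_iff[of \<gamma> \<gamma>] inversion_nilroot_iff[of \<gamma> \<delta>] that by (simp add: f_def)
  have ex1: "(\<exists>!w. w \<in> f ` nilroots \<and> P w) \<longleftrightarrow> (\<exists>!\<gamma>. \<gamma> \<in> nilroots \<and> P (f \<gamma>))" for P
  proof
    assume "\<exists>!w. w \<in> f ` nilroots \<and> P w"
    then obtain \<gamma> where g: "\<gamma> \<in> nilroots" "P (f \<gamma>)"
      and uniq: "\<And>w. w \<in> f ` nilroots \<and> P w \<Longrightarrow> w = f \<gamma>" by blast
    show "\<exists>!\<gamma>. \<gamma> \<in> nilroots \<and> P (f \<gamma>)"
    proof (rule ex1I[of _ \<gamma>])
      fix \<delta> assume "\<delta> \<in> nilroots \<and> P (f \<delta>)"
      thus "\<delta> = \<gamma>" using inj uniq[of "f \<delta>"] g(1) by blast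
    qed (use g in blast)
  next
    assume "\<exists>!\<gamma>. \<gamma> \<in> nilroots \<and> P (f \<gamma>)"
    then obtain \<gamma> where g: "\<gamma> \<in> nilroots" "P (f \<gamma>)"
      and uniq: "\<And>\<delta>. \<delta> \<in> nilroots \<and> P (f \<delta>) \<Longrightarrow> \<delta> = \<gamma>" by blast
    show "\<exists>!w. w \<in> f ` nilroots \<and> P w"
      by (rule ex1I[of _ "f \<gamma>"]) (use g uniq in blast)+
  qed
  have "(\<exists>!\<gamma>. \<gamma> \<in> nilroots \<and> \<mu> \<in> inversions \<Delta> B (f \<gamma>)) \<longleftrightarrow>
      \<mu> \<in> nilroots \<or> coeff \<mu> \<alpha> = 0 \<and> (\<exists>!\<gamma>. \<gamma> \<in> nilroots \<and> pairing \<mu> \<gamma> > 0)" if m: "\<mu> \<in> pos" for \<mu>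
  proof (cases "\<mu> \<in> nilroots")
    case True
    hence "\<gamma> \<in> nilroots \<and> \<mu> \<in> inversions \<Delta> B (f \<gamma>) \<longleftrightarrow> \<gamma> = \<mu>" for \<gamma>
      using inversion_nilroot_iff[of \<mu> \<gamma>] by (auto simp: f_def)
    thus ?thesis using True by simp
  next
    case False
    hence "coeff \<mu> \<alpha> = 0" using pos_cases m by blast
    hence "\<gamma> \<in> nilroots \<and> \<mu> \<in> inversions \<Delta> B (f \<gamma>) \<longleftrightarrow> \<gamma> \<in> nilroots \<and> pairing \<mu> \<gamma> > 0" for \<gamma>
      using m False by (auto simp: f_def inversions_shortest_to)
    thus ?thesis using False \<open>coeff \<mu> \<alpha> = 0\<close> by simp
  qed
  hence "\<mu> \<in> pos \<and> (\<exists>!\<gamma>. \<gamma> \<in> nilroots \<and> \<mu> \<in> inversions \<Delta> B (f \<gamma>)) \<longleftrightarrow>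
      \<mu> \<in> nilroots \<or> \<mu> \<in> pos \<and> coeff \<mu> \<alpha> = 0 \<and> (\<exists>!\<gamma>. \<gamma> \<in> nilroots \<and> pairing \<mu> \<gamma> > 0)" for \<mu>
    using nilroot_pos[of \<mu>] by fast
  thus ?thesis unfolding Ess_def fam ex1 by (simp add: set_eq_iff)
qed

section \<open>Neighbours among the roots of the nilradical\<close>

text \<open>It is the image of \<open>c\<close> under the reflection in the root \<open>a - b\<close>.\<close>

lemma rectangle_root:
  assumes "a \<in> nilroots" "b \<in> nilroots" "c \<in> nilroots" "pairing a b = 1" "pairing b c = 1" "pairing a c = 0"
  shows "a + c - b \<in> nilroots"
proof -
  have "a - b \<in> \<Delta>" using assms by (intro diff_root) (auto simp: nilroot_iff)
  hence "c + (a - b) \<in> \<Delta>"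
    using assms by (intro add_root) (auto simp: nilroot_iff pairing_simps pairing_commute[of c])
  thus ?thesis using assms by (simp add: nilroot_iff coeff_simps algebra_simps)
qed

text \<open>Going one step up from \<open>c\<close> to its neighbour \<open>\<delta>\<close>, let \<open>b\<close> be a common neighbour of \<open>\<alpha>\<close> and \<open>c\<close>.
  If \<open>b\<close> is not a neighbour of \<open>\<delta>\<close>, the fourth vertex \<open>\<alpha> + c - b\<close> of the rectangle is a common
  neighbour of \<open>\<alpha>\<close> and \<open>\<delta>\<close>.\<close>

lemma common_neighbour_alpha:
  assumes "\<delta> \<in> nilroots" "pairing \<alpha> \<delta> = 0"
  shows "\<exists>\<eta>\<in>nilroots. pairing \<alpha> \<eta> = 1 \<and> pairing \<eta> \<delta> = 1"
  using assms
proof (induction rule: nilroot_height_induct)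
  case alpha
  thus ?case using alpha_simple by (simp add: pairing_self simple_is_root)
next
  case (descend \<delta> \<beta>)
  let ?c = "\<delta> - \<beta>"
  have cd: "pairing ?c \<delta> = 1"
    using descend by (simp add: pairing_simps pairing_commute[of \<beta>] pairing_self nilroot_iff)
  have ne: "?c \<noteq> \<alpha>" using cd descend.prems by auto
  show ?case
  proof (cases "pairing \<alpha> ?c = 0")
    case False
    hence "pairing \<alpha> ?c = 1"
      using nilroot_pairing_cases[OF alpha_nilroot descend.hyps(4)] ne by simp
    thus ?thesis using cd descend.hyps(4) by blast
  next
    case True
    then obtain b where b: "b \<in> nilroots" "pairing \<alpha> b = 1" "pairing b ?c = 1"
      using descend.IH by blast
    show ?thesis
    proof (cases "pairing b \<delta> = 0")
      case False
      have "b \<noteq> \<delta>" using b descend.prems by auto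
      hence "pairing b \<delta> = 1"
        using False nilroot_pairing_cases[OF b(1) descend.hyps(1)] by simp
      thus ?thesis using b by blast
    next
      case bd: True
      have "\<alpha> + ?c - b \<in> nilroots"
        using b True descend.hyps alpha_nilroot by (intro rectangle_root)
      moreover have "pairing \<alpha> (\<alpha> + ?c - b) = 1"
        using b True pairing_self[OF simple_is_root[OF alpha_simple]] unfolding pairing_simps by simp
      moreover have "pairing (\<alpha> + ?c - b) \<delta> = 1"
        using bd cd descend.prems unfolding pairing_simps by simp
      ultimately show ?thesis by blast
    qed
  qed
qed

text \<open>Every root of the nilradical is carried to \<open>\<alpha>\<close> by reflections in the other simple roots, and these
  preserve both the nilradical and the pairing.\<close>

lemma orthogonal_with_common_neighbour:
  assumes "\<theta> \<in> nilroots" "pairing \<alpha> \<theta> = 0" "\<gamma> \<in> nilroots"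
  shows "\<exists>\<delta>\<in>nilroots. \<exists>\<eta>\<in>nilroots. pairing \<gamma> \<delta> = 0 \<and> pairing \<gamma> \<eta> = 1 \<and> pairing \<eta> \<delta> = 1"
  using assms(3)
proof (induction rule: nilroot_height_induct)
  case alpha
  show ?case using common_neighbour_alpha assms by blast
next
  case (descend \<gamma> \<beta>)
  then obtain \<delta> \<eta> where "\<delta> \<in> nilroots" "\<eta> \<in> nilroots"
    "pairing (reflection \<beta> \<gamma>) \<delta> = 0" "pairing (reflection \<beta> \<gamma>) \<eta> = 1" "pairing \<eta> \<delta> = 1"
    by metis
  moreover have "pairing \<gamma> (reflection \<beta> x) = pairing (reflection \<beta> \<gamma>) x" for x
    using pairing_reflection[of \<beta> \<gamma> "reflection \<beta> x"] descend
    by (simp add: reflection_reflection simple_is_root)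
  ultimately show ?case using descend.hyps
    by (intro bexI[of _ "reflection \<beta> \<delta>"] bexI[of _ "reflection \<beta> \<eta>"])
      (simp_all add: nilroot_reflection pairing_reflection simple_is_root)
qed

text \<open>If \<open>a\<close> is the only root of the nilradical with \<open>\<langle>\<mu>, a\<rangle> > 0\<close>, then \<open>a - \<mu>\<close> is the only one that
  pairs negatively with \<open>\<mu>\<close>, by the reflection in \<open>\<mu>\<close>.  With \<open>\<delta>\<close>, \<open>\<eta>\<close> from the previous lemma, neither is
  \<open>a\<close> or \<open>a - \<mu>\<close>, so both are orthogonal to \<open>\<mu>\<close>, and \<open>a + \<delta> - \<eta>\<close> is a second root pairing
  positively with \<open>\<mu>\<close>.\<close>

lemma not_unique_neighbour:
  assumes "\<theta> \<in> nilroots" "pairing \<alpha> \<theta> = 0" and m: "\<mu> \<in> pos" "coeff \<mu> \<alpha> = 0"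
  shows "\<not> (\<exists>!\<gamma>. \<gamma> \<in> nilroots \<and> pairing \<mu> \<gamma> > 0)"
proof
  assume "\<exists>!\<gamma>. \<gamma> \<in> nilroots \<and> pairing \<mu> \<gamma> > 0"
  then obtain a where a: "a \<in> nilroots" "pairing \<mu> a > 0"
    and uniq: "\<And>\<gamma>. \<gamma> \<in> nilroots \<Longrightarrow> pairing \<mu> \<gamma> > 0 \<Longrightarrow> \<gamma> = a" by blast
  have mr: "\<mu> \<in> \<Delta>" using m by (simp add: pos_root)
  have pa: "pairing \<mu> a = 1"
    using a m mr by (intro pairing_pos_eq_1) (auto simp: nilroot_iff)
  have neg: "x = a - \<mu>" if x: "x \<in> nilroots" "pairing \<mu> x < 0" for x
  proof -
    have "\<mu> \<noteq> - x" using m x by (auto simp: nilroot_iff coeff_simps)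
    hence p: "pairing \<mu> x = - 1"
      using x mr by (intro pairing_neg_eq_minus_1) (auto simp: nilroot_iff)
    hence "x + \<mu> \<in> \<Delta>" using x mr by (intro add_root) (auto simp: nilroot_iff pairing_commute)
    hence "x + \<mu> = a"
      using x m p mr by (intro uniq) (auto simp: nilroot_iff coeff_simps pairing_simps pairing_self)
    thus ?thesis by (simp add: algebra_simps)
  qed
  obtain \<delta> \<eta> where d: "\<delta> \<in> nilroots" "\<eta> \<in> nilroots" "pairing a \<delta> = 0" "pairing a \<eta> = 1" "pairing \<eta> \<delta> = 1"
    using orthogonal_with_common_neighbour[OF assms(1,2) a(1)] by blast
  have aa: "pairing a a = 2" "pairing a \<mu> = 1" using a pa by (auto simp: nilroot_iff pairing_self pairing_commute)
  have "\<delta> \<noteq> a" "\<delta> \<noteq> a - \<mu>"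
    using d(3) aa by (auto simp only: pairing_simps)
  hence d0: "pairing \<mu> \<delta> = 0" using uniq[OF d(1)] neg[OF d(1)] by linarith
  have "pairing (a - \<mu>) \<delta> = 0" using d(3) d0 by (simp only: pairing_simps)
  hence "\<eta> \<noteq> a - \<mu>" "\<eta> \<noteq> a" using d(3,5) by auto
  hence e0: "pairing \<mu> \<eta> = 0" using uniq[OF d(2)] neg[OF d(2)] by linarith
  have "a + \<delta> - \<eta> \<in> nilroots" by (rule rectangle_root[OF a(1) d(2,1,4,5,3)])
  moreover have "pairing \<mu> (a + \<delta> - \<eta>) > 0" unfolding pairing_simps using pa d0 e0 by simp
  ultimately have "a + \<delta> - \<eta> = a" by (rule uniq)
  hence "\<delta> = \<eta>" by simp
  moreover have "pairing \<eta> \<eta> = 2" using d(2) pairing_self unfolding nilroot_iff by blast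
  ultimately show False using d(5) by simp
qed

theorem Ess_nilradical_family_eq:
  assumes "\<theta> \<in> nilroots" "pairing \<alpha> \<theta> = 0"
  shows "Ess \<Delta> B (nilradical_family \<Delta> B \<alpha>) = nilroots"
  unfolding Ess_nilradical_family using not_unique_neighbour[OF assms] by blast

end

section \<open>The essential roots\<close>

theorem theorem0p2:
  fixes scl :: "complex \<Rightarrow> 'g::ab_group_add \<Rightarrow> 'g"
    and br :: "'g \<Rightarrow> 'g \<Rightarrow> 'g"
    and t :: "'g set"
    and ev :: "'v::euclidean_space \<Rightarrow> 'g \<Rightarrow> complex"
    and \<Delta> B :: "'v set"
    and \<alpha> \<theta> :: 'v
  assumes "simple_lie_algebra_roots scl br t ev"
    and "\<Delta> = roots scl br t ev"
    and "simple_system \<Delta> B"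
    and "highest_root \<Delta> B \<theta>"
    and "simply_laced \<Delta>"
    and "\<alpha> \<in> B"
    and "abelian br (nilradical scl br t ev B \<alpha>)"
    and "\<alpha> \<bullet> \<theta> = 0"
  shows "Ess \<Delta> B (nilradical_family \<Delta> B \<alpha>) = nilradical_roots \<Delta> B \<alpha>"
proof -
  interpret L: simple_lie_algebra_roots scl br t ev by fact
  have norms: "\<gamma> \<bullet> \<gamma> = \<delta> \<bullet> \<delta>" if "\<gamma> \<in> \<Delta>" "\<delta> \<in> \<Delta>" for \<gamma> \<delta>
    using assms(5) that unfolding simply_laced_def norm_eq by blast
  interpret L: simply_laced_lie_algebra scl br t ev
    by unfold_locales (rule norms[unfolded assms(2)])
  have \<alpha>: "\<alpha> \<in> \<Delta>" using assms(3,6) by (auto simp: simple_system_def)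
  interpret S: simply_laced_root_system \<Delta> B "\<alpha> \<bullet> \<alpha>"
  proof
    show "\<alpha> \<bullet> \<alpha> > 0" using L.root_nonzero \<alpha> assms(2) by simp
    show "\<gamma> \<bullet> \<gamma> = \<alpha> \<bullet> \<alpha>" if "\<gamma> \<in> \<Delta>" for \<gamma>
      using that \<alpha> by (rule norms)
    show "reflection \<gamma> \<delta> \<in> \<Delta>" if "\<gamma> \<in> \<Delta>" "\<delta> \<in> \<Delta>" for \<gamma> \<delta>
      using that L.reflection_roots assms(2) by blast
    show "Real_Vector_Spaces.span \<Delta> = UNIV" using L.span_roots assms(2) by simp
  qed (rule assms(3))
  have sums: "\<gamma> + \<delta> \<notin> \<Delta>"
    if n: "\<gamma> \<in> nilradical_roots \<Delta> B \<alpha>" "\<delta> \<in> nilradical_roots \<Delta> B \<alpha>" for \<gamma> \<delta>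
  proof
    assume "\<gamma> + \<delta> \<in> \<Delta>"
    moreover have "\<gamma> \<in> \<Delta>" "\<delta> \<in> \<Delta>" using n by (auto simp: nilradical_roots_def S.pos_root)
    ultimately obtain x y where xy: "x \<in> root_space scl br t ev \<gamma>" "y \<in> root_space scl br t ev \<delta>"
      "br x y \<noteq> 0"
      using L.bracket_root_spaces_nonzero unfolding assms(2) by blast
    have "x \<in> nilradical scl br t ev B \<alpha>" "y \<in> nilradical scl br t ev B \<alpha>"
      unfolding nilradical_def using xy n[unfolded assms(2)] by (blast intro: L.span_base)+
    thus False using assms(7) xy(3) by (simp add: abelian_def)
  qed
  interpret S: cominuscule_simple_root \<Delta> B "\<alpha> \<bullet> \<alpha>" \<alpha>
    by unfold_locales (fact assms(6), rule S.coeff_le_1_if_sums_not_roots[OF assms(6) sums])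
  have "\<theta> \<in> \<Delta>" "representation B \<theta> \<alpha> \<ge> 1"
    using assms(4,6) \<alpha> S.coeff_simple[of \<alpha> \<alpha>] unfolding highest_root_def by force+
  hence "\<theta> \<in> nilradical_roots \<Delta> B \<alpha>"
    using S.pos_if_coeff[of \<theta> \<alpha>] assms(6) by (simp add: nilradical_roots_def)
  moreover have "S.pairing \<alpha> \<theta> = 0" using assms(8) by (simp add: S.pairing_def)
  ultimately show ?thesis by (rule S.Ess_nilradical_family_eq)
qed

end
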